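(* Let $G$ be a finite connected simple graph with at least two vertices which, as an unweighted graph, can be reduced to a single edge (on two vertices) by repeatedly using the following operations (on graphs possibly with parallel edges): (1) Degree-one reduction: delete a degree-one vertex and its incident edge. (2) Series reduction: delete a degree-two vertex $k$ and its two incident edges $(i,k)$ and $(j,k)$, $i\ne j$, and add a new edge $(i,j)$. (3) Parallel reduction: delete one of a pair of parallel edges. (4) Y-$\Delta$ transformation: delete a vertex $k$ of degree three and its three incident edges $(i,k),(j,k),(\ell,k)$, with $i,j,\ell$ distinct, and add the three edges of the triangle $ij\ell$. Let the edges of $G$ have nonnegative weights such that $G$ remains connected after removing all zero-weight edges. Then Aldous' conjecture holds for this weighted graph: the spectral gap of the interchange process on it equals the spectral gap of the random walk on it.
   Context: Spectral gaps: number the vertices of $G$ as $1,\ldots,n$ and let $\alpha_{ij}=\alpha_{ji}\ge0$ be the weight of edge $(i,j)$, with $\alpha_{ij}=0$ if $(i,j)$ is not an edge. The random-walk Laplacian $\mathcal L_n^{RW}(\alpha)$ is the $n\times n$ matrix with $(i,j)$ entry $-\alpha_{ij}$ for $i\neq j$ and $(j,j)$ entry $\sum_{k\neq j}\alpha_{kj}$. The interchange Laplacian $\mathcal L_n^I(\alpha)$ is the $n!\times n!$ matrix indexed by the symmetric group $\mathcal S_n$ with entry $(\sigma,\sigma')$ equal to $-\alpha_{ij}$ if $\sigma'=(ij)\sigma$ for a transposition $(ij)$, $\sum_{1\le \ell<m\le n}\alpha_{\ell m}$ if $\sigma=\sigma'$, and $0$ otherwise. The spectral gap of the random walk (respectively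 interchange process) is the second smallest eigenvalue, counted with multiplicity, of $\mathcal L_n^{RW}(\alpha)$ (respectively $\mathcal L_n^I(\alpha)$). *)

theory Defs
  imports
    "Jordan_Normal_Form.Char_Poly"
    "HOL-Computational_Algebra.Computational_Algebra"
    "HOL-Combinatorics.Permutations"
    "HOL-Combinatorics.Transposition"
    "HOL-Library.Multiset"
    "HOL-Library.Countable_Set"
begin

definition simple_graph :: "'a set \<Rightarrow> 'a set set \<Rightarrow> bool" where
  "simple_graph V E \<longleftrightarrow> finite V \<and> E \<subseteq> {e. e \<subseteq> V \<and> card e = 2}"

definition connected_graph :: "'a set \<Rightarrow> 'a set set \<Rightarrow> bool" where
  "connected_graph V E \<longleftrightarrow> V \<noteq> {} \<and> (\<forall>u\<in>V. \<forall>v\<in>V. (u, v) \<in> {(x, y). {x, y} \<in> E}\<^sup>*)"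

text \<open>A graph possibly with parallel edges is a vertex set together with a multiset of
  two-element sets of vertices; the multiplicity of a set is the number of parallel edges
  joining its two elements.\<close>

type_synonym 'a multigraph = "'a set \<times> 'a set multiset"

definition incident :: "'a set multiset \<Rightarrow> 'a \<Rightarrow> 'a set multiset" where
  "incident M k = {# e \<in># M. k \<in> e #}"

inductive reduction_step :: "'a multigraph \<Rightarrow> 'a multigraph \<Rightarrow> bool" where
  degree_one:
    "\<lbrakk>k \<in> V; incident M k = {#e#}\<rbrakk>
     \<Longrightarrow> reduction_step (V, M) (V - {k}, M - {#e#})"
| series:
    "\<lbrakk>k \<in> V; distinct [k, i, j]; incident M k = {#{i, k}, {j, k}#}\<rbrakk>
     \<Longrightarrow> reduction_step (V, M) (V - {k}, M - {#{i, k}, {j, k}#} + {#{i, j}#})"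
| parallel:
    "count M e \<ge> 2 \<Longrightarrow> reduction_step (V, M) (V, M - {#e#})"
| Y_Delta:
    "\<lbrakk>k \<in> V; distinct [k, i, j, l]; incident M k = {#{i, k}, {j, k}, {l, k}#}\<rbrakk>
     \<Longrightarrow> reduction_step (V, M)
           (V - {k}, M - {#{i, k}, {j, k}, {l, k}#} + {#{i, j}, {j, l}, {i, l}#})"

definition single_edge :: "'a multigraph \<Rightarrow> bool" where
  "single_edge H \<longleftrightarrow> (\<exists>u v. u \<noteq> v \<and> H = ({u, v}, {#{u, v}#}))"

definition reducible_to_edge :: "'a set \<Rightarrow> 'a set set \<Rightarrow> bool" where
  "reducible_to_edge V E \<longleftrightarrow> (\<exists>H. reduction_step\<^sup>*\<^sup>* (V, mset_set E) H \<and> single_edge H)"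

definition RW_laplacian :: "nat \<Rightarrow> (nat \<Rightarrow> nat \<Rightarrow> real) \<Rightarrow> nat \<Rightarrow> nat \<Rightarrow> real" where
  "RW_laplacian n \<alpha> i j =
     (if i = j then (\<Sum>k\<in>{1..n} - {j}. \<alpha> k j) else - \<alpha> i j)"

text \<open>Off the diagonal at most one pair \<open>i < j\<close> satisfies \<open>\<sigma>' = (i j) \<sigma>\<close>, so the sum below
  is the single weight of that transposition if there is one, and \<open>0\<close> otherwise.\<close>

definition interchange_laplacian ::
  "nat \<Rightarrow> (nat \<Rightarrow> nat \<Rightarrow> real) \<Rightarrow> (nat \<Rightarrow> nat) \<Rightarrow> (nat \<Rightarrow> nat) \<Rightarrow> real" where
  "interchange_laplacian n \<alpha> \<sigma> \<sigma>' =
     (if \<sigma> = \<sigma>' then (\<Sum>(l, m) \<in> {(l, m). 1 \<le> l \<and> l < m \<and> m \<le> n}. \<alpha> l m)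
      else - (\<Sum>(i, j) \<in> {(i, j). 1 \<le> i \<and> i < j \<and> j \<le> n \<and>
                               \<sigma>' = Transposition.transpose i j \<circ> \<sigma>}. \<alpha> i j))"

text \<open>A matrix whose rows and columns are indexed by a finite set \<open>I\<close>, as a library matrix. For
  finite \<open>I\<close>, \<open>from_nat_into I\<close> is a bijection from \<open>{..<card I}\<close> onto \<open>I\<close>; a different
  enumeration of \<open>I\<close> gives a matrix conjugate by a permutation matrix, with the same
  characteristic polynomial.\<close>

definition indexed_mat :: "'i set \<Rightarrow> ('i \<Rightarrow> 'i \<Rightarrow> real) \<Rightarrow> real mat" where
  "indexed_mat I K =
     mat (card I) (card I) (\<lambda>(a, b). K (from_nat_into I a) (from_nat_into I b))"

text \<open>The second entry of the increasing list of real eigenvalues, each repeated according to its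
  multiplicity as a root of the characteristic polynomial. It is meaningful for symmetric
  matrices of size at least two, for which this list has as many entries as the matrix has
  rows.\<close>

definition second_smallest_eigenvalue :: "real mat \<Rightarrow> real" where
  "second_smallest_eigenvalue A = sorted_list_of_multiset (proots (char_poly A)) ! 1"

definition RW_gap :: "nat \<Rightarrow> (nat \<Rightarrow> nat \<Rightarrow> real) \<Rightarrow> real" where
  "RW_gap n \<alpha> = second_smallest_eigenvalue (indexed_mat {1..n} (RW_laplacian n \<alpha>))"

definition interchange_gap :: "nat \<Rightarrow> (nat \<Rightarrow> nat \<Rightarrow> real) \<Rightarrow> real" where
  "interchange_gap n \<alpha> =
     second_smallest_eigenvalue
       (indexed_mat {\<sigma>. \<sigma> permutes {1..n}} (interchange_laplacian n \<alpha>))"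

end

(* Call the gap inequality "interchange gap >= walk gap"; the converse inequality is clear, since a
   walk eigenfunction g yields the interchange eigenfunction sigma |-> g (sigma 1).

   Eliminate a vertex k, replacing its star by the harmonic (star-mesh) weights c_ki c_kj / C on
   its neighbours, where C is the sum of the c_ki. Harmonic extension shows that this does not
   decrease the walk gap. The octopus inequality says that it does not increase the interchange
   form. Let h be an eigenfunction for the interchange gap. Either some marginal (the sum of h over
   sigma y = x, as a function of x) is nonzero, and then it is a walk eigenfunction with the same
   eigenvalue; or h has mean zero on every coset {sigma. sigma y = k}, each a copy of the
   permutations of the other vertices, and the gap inequality for the reduced network applies.

   For at most three neighbours the octopus inequality is a computation in the group algebra of
   S_4. Degree-one, series and Y-Delta reductions are star-mesh eliminations up to a choice of
   weights on the new edges, so the gap inequality propagates backwards along the reductions. *)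
theory Submission
  imports Defs "HOL-Analysis.Function_Topology"
begin

section \<open>Rayleigh quotients\<close>

text \<open>The induction runs over quadratic forms, not eigenvalues: \<open>aldous\<close>
  transfers every lower bound \<mu> from the walk form to the interchange form, and
  \<open>aldous_graph\<close> asks this for all nonnegative weights on a graph, since elimination
  produces new ones. No connectivity is carried through the induction; zero weights and disconnected
  networks are covered as well. Eigenvalues return at the end, where connectivity makes the minimum
  \<open>l\<close> of the walk's Rayleigh quotient positive. Then 0 is a simple eigenvalue of both
  matrices and \<open>l\<close> is the next one.

  The octopus inequality has the shape \<open>R \<le> w\<close>, where \<open>R\<close> is a signed
  sum of transpositions and \<open>w\<close> the sum of its coefficients. It is deduced from
  \<open>R^2 \<le> w^2\<close>, because squaring leaves only the identity, 3-cycles and double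
  transpositions. For two legs \<open>R^2 = w^2\<close>. For three legs the defect
  \<open>w^2 - R^2\<close> is a nonnegative multiple of one fixed element of the group algebra of
  A_4, whose positivity comes from averaging over the Klein four-group.\<close>

abbreviation mean_zero :: "'i set \<Rightarrow> ('i \<Rightarrow> real) \<Rightarrow> bool" where
  "mean_zero I f \<equiv> (\<Sum>i\<in>I. f i) = 0"

abbreviation sq_norm :: "'i set \<Rightarrow> ('i \<Rightarrow> real) \<Rightarrow> real" where
  "sq_norm I f \<equiv> (\<Sum>i\<in>I. (f i)\<^sup>2)"

abbreviation apply_kernel :: "'i set \<Rightarrow> ('i \<Rightarrow> 'i \<Rightarrow> real) \<Rightarrow> ('i \<Rightarrow> real) \<Rightarrow> 'i \<Rightarrow> real" where
  "apply_kernel I K f i \<equiv> (\<Sum>j\<in>I. K i j * f j)"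

abbreviation kernel_form :: "'i set \<Rightarrow> ('i \<Rightarrow> 'i \<Rightarrow> real) \<Rightarrow> ('i \<Rightarrow> real) \<Rightarrow> real" where
  "kernel_form I K f \<equiv> (\<Sum>i\<in>I. f i * apply_kernel I K f i)"

lemma sq_norm_zero_imp:
  fixes f :: "'i \<Rightarrow> real"
  assumes "finite I" "sq_norm I f = 0" "i \<in> I"
  shows "f i = 0"
  using assms by (simp add: sum_nonneg_eq_0_iff)

lemma kernel_sym_swap:
  fixes f g :: "'i \<Rightarrow> real"
  assumes "\<And>i j. i \<in> I \<Longrightarrow> j \<in> I \<Longrightarrow> K i j = K j i"
  shows "(\<Sum>i\<in>I. f i * apply_kernel I K g i) = (\<Sum>i\<in>I. apply_kernel I K f i * g i)"
proof -
  have "(\<Sum>i\<in>I. f i * apply_kernel I K g i) = (\<Sum>i\<in>I. \<Sum>j\<in>I. f i * (K i j * g j))"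
    by (simp add: sum_distrib_left)
  also have "\<dots> = (\<Sum>j\<in>I. \<Sum>i\<in>I. f i * (K i j * g j))" by (rule sum.swap)
  also have "\<dots> = (\<Sum>j\<in>I. \<Sum>i\<in>I. K j i * f i * g j)"
    using assms by (intro sum.cong refl) simp
  finally show ?thesis by (simp add: sum_distrib_right)
qed

lemma kernel_mean_zero:
  fixes f :: "'i \<Rightarrow> real"
  assumes "\<And>i j. i \<in> I \<Longrightarrow> j \<in> I \<Longrightarrow> K i j = K j i"
    and "\<And>i. i \<in> I \<Longrightarrow> (\<Sum>j\<in>I. K i j) = 0"
  shows "mean_zero I (apply_kernel I K f)"
  using kernel_sym_swap[of I K "\<lambda>_. 1" f] assms(1)
  by (simp add: assms(2) cong: sum.cong)

text \<open>Compactness of a product of intervals, so no coordinates on \<open>I\<close> are chosen.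
  Functions live on the whole type, hence \<open>B\<close> pins them to 0 off \<open>I\<close>; a
  competitor \<open>g\<close> is truncated there, which changes none of the sums.\<close>

lemma unit_sphere_minimizer:
  fixes K :: "'i \<Rightarrow> 'i \<Rightarrow> real"
  assumes fin: "finite I" and card: "card I \<ge> 2"
  obtains f where "mean_zero I f" "sq_norm I f = 1"
    "\<And>g. mean_zero I g \<Longrightarrow> sq_norm I g = 1 \<Longrightarrow> kernel_form I K f \<le> kernel_form I K g"
proof -
  define B where "B = (\<Pi>\<^sub>E i\<in>UNIV. if i \<in> I then {-1..1::real} else {0})"
  define X where "X = {f :: 'i \<Rightarrow> real. mean_zero I f \<and> sq_norm I f = 1}"
  have cont: "continuous_on UNIV (\<lambda>f :: 'i \<Rightarrow> real. f i)" for i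
    by (rule continuous_on_product_coordinates)
  have "compact B"
    unfolding compactin_euclidean_iff[symmetric] euclidean_product_topology[symmetric] B_def
    by (subst compactin_PiE) (auto simp: compactin_euclidean_iff)
  moreover have "closed X"
    unfolding X_def using cont
    by (intro closed_Collect_conj closed_Collect_eq continuous_intros)
  ultimately have comp: "compact (B \<inter> X)" by (rule compact_Int_closed)
  have inB: "(\<lambda>i. if i \<in> I then g i else 0) \<in> B \<inter> X" if g: "mean_zero I g" "sq_norm I g = 1" for g
  proof -
    have "\<bar>g i\<bar> \<le> 1" if "i \<in> I" for i
    proof -
      have "(g i)\<^sup>2 \<le> sq_norm I g" using that fin by (intro member_le_sum) auto
      then show ?thesis using g(2) by (simp add: abs_square_le_1)
    qed
    then show ?thesis using g by (auto simp: B_def X_def abs_le_iff intro: minus_le_iff[THEN iffD1])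
  qed
  obtain a b where ab: "a \<in> I" "b \<in> I" "a \<noteq> b"
    using card by (metis card_2_iff' card_le_Suc0_iff_eq fin not_less_eq_eq numeral_2_eq_2)
  define h :: "'i \<Rightarrow> real" where "h i = (if i = a then 1 / sqrt 2 else if i = b then - 1 / sqrt 2 else 0)" for i
  have I: "I = insert a (insert b (I - {a, b}))" using ab by auto
  have "(\<Sum>i\<in>I - {a,b}. h i) = 0" "(\<Sum>i\<in>I - {a,b}. (h i)\<^sup>2) = 0"
    by (auto simp: h_def intro!: sum.neutral)
  then have "mean_zero I h" "sq_norm I h = 1"
    by (subst I, use fin ab in \<open>simp add: h_def power_divide\<close>)+
  then have "B \<inter> X \<noteq> {}" using inB by blast
  moreover have "continuous_on (B \<inter> X) (kernel_form I K)"
    by (rule continuous_on_subset[of UNIV]) (use cont in \<open>auto intro!: continuous_intros\<close>)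
  ultimately obtain f where f: "f \<in> B \<inter> X" "\<And>g. g \<in> B \<inter> X \<Longrightarrow> kernel_form I K f \<le> kernel_form I K g"
    using continuous_attains_inf[OF comp] by blast
  show ?thesis
  proof (rule that)
    show "mean_zero I f" "sq_norm I f = 1" using f by (auto simp: X_def)
    show "kernel_form I K f \<le> kernel_form I K g" if "mean_zero I g" "sq_norm I g = 1" for g
      using f(2)[OF inB[OF that]] by simp
  qed
qed

text \<open>First-order condition at a minimum: for small \<open>t\<close> of sign opposite to
  \<open>b\<close> the linear term wins.\<close>

lemma linear_coeff_zero:
  fixes b q :: real
  assumes "\<And>t. 0 \<le> 2 * t * b + t\<^sup>2 * q"
  shows "b = 0"
proof (rule ccontr)
  assume b: "b \<noteq> 0"
  define s where "s = 1 / (\<bar>q\<bar> + 1)"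
  have s: "s > 0" "s * q < 1" by (auto simp: s_def divide_less_eq)
  have "0 \<le> 2 * (- s * b) * b + (- s * b)\<^sup>2 * q" by (rule assms)
  also have "\<dots> = s * b\<^sup>2 * (s * q - 2)" by (simp add: power2_eq_square algebra_simps)
  also have "\<dots> < 0" using s b by (intro mult_pos_neg) auto
  finally show False by simp
qed

text \<open>The first variation at a minimiser \<open>f\<close> makes the residual
  \<open>K f - l f\<close> orthogonal to all mean-zero functions. By symmetry and zero row sums the
  residual is mean zero itself, hence orthogonal to itself, hence 0.\<close>

lemma rayleigh_minimizer:
  fixes K :: "'i \<Rightarrow> 'i \<Rightarrow> real"
  assumes fin: "finite I" and card: "card I \<ge> 2"
    and sym: "\<And>i j. i \<in> I \<Longrightarrow> j \<in> I \<Longrightarrow> K i j = K j i"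
    and rows: "\<And>i. i \<in> I \<Longrightarrow> (\<Sum>j\<in>I. K i j) = 0"
  obtains l f where "mean_zero I f" "sq_norm I f = 1"
    "\<And>i. i \<in> I \<Longrightarrow> apply_kernel I K f i = l * f i"
    "\<And>g. mean_zero I g \<Longrightarrow> l * sq_norm I g \<le> kernel_form I K g"
proof -
  obtain f where f: "mean_zero I f" "sq_norm I f = 1"
    and min: "\<And>g. mean_zero I g \<Longrightarrow> sq_norm I g = 1 \<Longrightarrow> kernel_form I K f \<le> kernel_form I K g"
    using unit_sphere_minimizer[OF fin card] by blast
  define l where "l = kernel_form I K f"
  have bound: "l * sq_norm I g \<le> kernel_form I K g" if g: "mean_zero I g" for g
  proof (cases "sq_norm I g = 0")
    case True
    then show ?thesis using sq_norm_zero_imp[OF fin True] by simp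
  next
    case False
    define N where "N = sq_norm I g"
    have N: "N > 0" using False by (simp add: N_def sum_nonneg order_less_le)
    define h where "h i = g i / sqrt N" for i
    have "mean_zero I h" using g by (simp add: h_def flip: sum_divide_distrib)
    moreover have "sq_norm I h = 1"
      using N by (simp add: h_def power_divide N_def[symmetric] flip: sum_divide_distrib)
    ultimately have "l \<le> kernel_form I K h" unfolding l_def by (rule min)
    also have "\<dots> = (\<Sum>i\<in>I. g i * apply_kernel I K g i / (sqrt N * sqrt N))"
      by (simp add: h_def flip: sum_divide_distrib)
    also have "\<dots> = kernel_form I K g / N" using N by (simp add: sum_divide_distrib)
    finally show ?thesis using N by (simp add: field_simps N_def)
  qed
  have orth: "(\<Sum>i\<in>I. g i * (apply_kernel I K f i - l * f i)) = 0" if g: "mean_zero I g" for g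
  proof (rule linear_coeff_zero)
    fix t
    have expand: "(\<Sum>i\<in>I. (f i + t * g i) * (F i + t * G i)) = (\<Sum>i\<in>I. f i * F i)
        + t * (\<Sum>i\<in>I. g i * F i) + t * (\<Sum>i\<in>I. f i * G i) + t\<^sup>2 * (\<Sum>i\<in>I. g i * G i)" for F G
      by (simp add: sum.distrib sum_distrib_left algebra_simps power2_eq_square)
    define h where "h i = f i + t * g i" for i
    have "mean_zero I h" using f g by (simp add: h_def sum.distrib flip: sum_distrib_left)
    from bound[OF this] have "0 \<le> kernel_form I K h - l * sq_norm I h" by simp
    also have "sq_norm I h = sq_norm I f + 2 * t * (\<Sum>i\<in>I. g i * f i) + t\<^sup>2 * sq_norm I g"
      by (simp add: h_def power2_sum sum.distrib sum_distrib_left power_mult_distrib algebra_simps)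
    also have "apply_kernel I K h i = apply_kernel I K f i + t * apply_kernel I K g i" for i
      by (simp add: h_def sum.distrib sum_distrib_left algebra_simps)
    then have "kernel_form I K h = kernel_form I K f + t * (\<Sum>i\<in>I. g i * apply_kernel I K f i)
        + t * (\<Sum>i\<in>I. f i * apply_kernel I K g i) + t\<^sup>2 * kernel_form I K g"
      by (simp only: h_def expand)
    also have "(\<Sum>i\<in>I. f i * apply_kernel I K g i) = (\<Sum>i\<in>I. g i * apply_kernel I K f i)"
      by (subst kernel_sym_swap[OF sym]) (simp_all add: mult.commute)
    finally show "0 \<le> 2 * t * (\<Sum>i\<in>I. g i * (apply_kernel I K f i - l * f i))
        + t\<^sup>2 * (kernel_form I K g - l * sq_norm I g)"
      using f(2) by (simp add: l_def[symmetric] right_diff_distrib sum_subtractf mult.left_commute[of _ l]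
          flip: sum_distrib_left) (simp add: algebra_simps)
  qed
  have "mean_zero I (\<lambda>i. apply_kernel I K f i - l * f i)"
    using kernel_mean_zero[OF sym rows, of f] f(1) by (simp add: sum_subtractf flip: sum_distrib_left)
  from orth[OF this] have "sq_norm I (\<lambda>i. apply_kernel I K f i - l * f i) = 0"
    by (simp add: power2_eq_square)
  then have "apply_kernel I K f i = l * f i" if "i \<in> I" for i
    using sq_norm_zero_imp[OF fin _ that, of "\<lambda>i. apply_kernel I K f i - l * f i"] by simp
  then show ?thesis using that[of f l] f bound by blast
qed

section \<open>The second smallest eigenvalue of a matrix with zero row sums\<close>

lemma eigenvalue_mat_iff:
  fixes K :: "nat \<Rightarrow> nat \<Rightarrow> real"
  shows "eigenvalue (mat m m (\<lambda>(i, j). K i j)) k \<longleftrightarrow>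
    (\<exists>f. (\<exists>i<m. f i \<noteq> 0) \<and> (\<forall>i<m. apply_kernel {..<m} K f i = k * f i))" (is "?L = ?R")
proof
  have mult: "(mat m m (\<lambda>(i, j). K i j) *\<^sub>v v) $ i = apply_kernel {..<m} K (\<lambda>j. v $ j) i"
    if "v \<in> carrier_vec m" "i < m" for v i
    using that by (auto simp: scalar_prod_def atLeast0LessThan)
  show ?R if L: ?L
  proof -
    obtain v where v: "v \<in> carrier_vec m" "v \<noteq> 0\<^sub>v m" "mat m m (\<lambda>(i, j). K i j) *\<^sub>v v = k \<cdot>\<^sub>v v"
      using L by (auto simp: eigenvalue_def eigenvector_def)
    have "\<exists>i<m. v $ i \<noteq> 0" using v by (metis carrier_vecD eq_vecI index_zero_vec)
    moreover have "\<forall>i<m. apply_kernel {..<m} K (\<lambda>j. v $ j) i = k * v $ i"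
      using mult[OF v(1)] v by auto
    ultimately show ?R by blast
  qed
  show ?L if R: ?R
  proof -
    obtain f where f: "\<exists>i<m. f i \<noteq> 0" "\<forall>i<m. apply_kernel {..<m} K f i = k * f i" using R by blast
    have "vec m f \<noteq> 0\<^sub>v m" using f(1) by (metis index_vec index_zero_vec(1))
    moreover have "mat m m (\<lambda>(i, j). K i j) *\<^sub>v vec m f = k \<cdot>\<^sub>v vec m f"
      using f(2) by (intro eq_vecI) (auto simp: scalar_prod_def atLeast0LessThan)
    ultimately show ?L by (auto simp: eigenvalue_def eigenvector_def intro!: exI[of _ "vec m f"])
  qed
qed

text \<open>In the basis consisting of the all-ones vector and all unit vectors but the first, a matrix
  with zero row sums is block triangular.\<close>

lemma char_poly_zero_row_sums:
  fixes K :: "nat \<Rightarrow> nat \<Rightarrow> real"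
  assumes rows: "\<And>i. i < Suc m \<Longrightarrow> (\<Sum>j<Suc m. K i j) = 0"
  shows "char_poly (mat (Suc m) (Suc m) (\<lambda>(i, j). K i j)) =
    [:0, 1:] * char_poly (mat m m (\<lambda>(i, j). K (Suc i) (Suc j) - K 0 (Suc j)))"
proof -
  let ?n = "Suc m"
  define A where "A = mat ?n ?n (\<lambda>(i, j). K i j)"
  define P where "P = mat ?n ?n (\<lambda>(i, j). of_bool (j = 0) + of_bool (j = i \<and> i \<noteq> 0) :: real)"
  \<comment> \<open>The inverse of \<open>P\<close>: coordinate 0 is subtracted from all
    others.\<close>
  define P' where "P' = mat ?n ?n (\<lambda>(i, j). of_bool (j = i) - of_bool (j = 0 \<and> i \<noteq> 0) :: real)"
  define B where "B = mat m m (\<lambda>(i, j). K (Suc i) (Suc j) - K 0 (Suc j))"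
  define A' where "A' = four_block_mat (0\<^sub>m 1 1) (mat 1 m (\<lambda>(i, j). K 0 (Suc j))) (0\<^sub>m m 1) B"
  have A'_idx: "A' $$ (i, j) = (if j = 0 then 0 else if i = 0 then K 0 j else K i j - K 0 j)"
    if "i < ?n" "j < ?n" for i j
    using that by (auto simp: A'_def B_def)
  have carr: "A \<in> carrier_mat ?n ?n" "P \<in> carrier_mat ?n ?n" "P' \<in> carrier_mat ?n ?n" "A' \<in> carrier_mat ?n ?n"
    by (auto simp: A_def P_def P'_def A'_def B_def)
  have pick: "(\<Sum>k\<in>{0..<?n}. of_bool (k = c \<and> Q) * x k) = (if Q then x c else 0)"
    "(\<Sum>k\<in>{0..<?n}. x k * of_bool (k = c \<and> Q)) = (if Q then x c else 0)" if "c < ?n" for c Q and x :: "nat \<Rightarrow> real"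
    using that by (simp_all add: of_bool_def if_distrib if_distribR cong: if_cong)
  have pick': "(\<Sum>k\<in>{0..<?n}. of_bool (k = c) * x k) = x c" if "c < ?n" for c and x :: "nat \<Rightarrow> real"
    using pick(1)[OF that, of True x] by (simp only: simp_thms if_True)
  have PP': "P * P' = 1\<^sub>m ?n"
    by (rule eq_matI)
      (auto simp: P_def P'_def scalar_prod_def distrib_right sum.distrib pick pick' simp del: sum.op_ivl_Suc)
  have P'P: "P' * P = 1\<^sub>m ?n"
    by (rule mat_mult_left_right_inverse[OF carr(2,3) PP'])
  have "A * P = P * A'"
  proof (rule eq_matI)
    fix i j assume "i < dim_row (P * A')" "j < dim_col (P * A')"
    then have ij: "i < ?n" "j < ?n" using carr by auto
    have "(A * P) $$ (i, j) = (\<Sum>k\<in>{0..<?n}. K i k * (of_bool (j = 0) + of_bool (k = j \<and> j \<noteq> 0)))"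
      using ij by (auto simp: A_def P_def scalar_prod_def intro!: sum.cong
          simp del: sum.op_ivl_Suc sum_mult_of_bool_eq)
    also have "\<dots> = (if j = 0 then 0 else K i j)"
      unfolding distrib_left sum.distrib pick(2)[OF ij(2)] sum_distrib_right[symmetric]
      using rows[OF ij(1)] by (simp add: atLeast0LessThan)
    also have "\<dots> = (\<Sum>k\<in>{0..<?n}. (of_bool (k = 0) + of_bool (k = i \<and> i \<noteq> 0)) *
        (if j = 0 then 0 else if k = 0 then K 0 j else K k j - K 0 j))"
      using ij by (auto simp: distrib_right sum.distrib pick pick'
          simp del: sum.op_ivl_Suc sum_of_bool_mult_eq)
    also have "\<dots> = (P * A') $$ (i, j)"
      using ij carr by (auto simp: P_def scalar_prod_def A'_idx intro!: sum.cong simp del: sum.op_ivl_Suc)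
    finally show "(A * P) $$ (i, j) = (P * A') $$ (i, j)" .
  qed (use carr in auto)
  then have "A = P * A' * P'"
    by (metis PP' assoc_mult_mat carr right_mult_one_mat)
  then have "similar_mat A A'"
    by (intro similar_matI[of _ _ P P' ?n]) (use carr PP' P'P in auto)
  then have "char_poly A = char_poly A'" by (rule char_poly_similar)
  also have "\<dots> = char_poly (0\<^sub>m 1 1) * char_poly B"
    unfolding A'_def by (rule char_poly_four_block_zeros_col) (auto simp: B_def)
  also have "char_poly (0\<^sub>m 1 1 :: real mat) = [:0, 1:]"
    by (simp add: char_poly_defs det_single)
  finally show ?thesis unfolding A_def B_def .
qed

text \<open>The factor \<open>[:0, 1:]\<close> of the characteristic polynomial accounts for the
  constants. The other roots are the eigenvalues of the compressed matrix \<open>B\<close>. They are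
  nonzero, so their eigenvectors for \<open>A\<close> are mean zero and \<open>bound\<close> puts
  them above \<open>l\<close>, which is one of them. The sorted list therefore starts with 0 and
  \<open>l\<close>; nothing is diagonalised.\<close>

lemma second_smallest_eigenvalue_eqI_nat:
  fixes K :: "nat \<Rightarrow> nat \<Rightarrow> real"
  assumes sym: "\<And>i j. i < m \<Longrightarrow> j < m \<Longrightarrow> K i j = K j i"
    and rows: "\<And>i. i < m \<Longrightarrow> (\<Sum>j<m. K i j) = 0"
    and l: "l > 0"
    and f: "sq_norm {..<m} f \<noteq> 0" "\<And>i. i < m \<Longrightarrow> apply_kernel {..<m} K f i = l * f i"
    and bound: "\<And>g. mean_zero {..<m} g \<Longrightarrow> l * sq_norm {..<m} g \<le> kernel_form {..<m} K g"
  shows "second_smallest_eigenvalue (mat m m (\<lambda>(i, j). K i j)) = l"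
proof -
  obtain m' where m: "m = Suc m'" using f(1) by (cases m) auto
  define A where "A = mat m m (\<lambda>(i, j). K i j)"
  define B where "B = mat m' m' (\<lambda>(i, j). K (Suc i) (Suc j) - K 0 (Suc j))"
  have carr: "A \<in> carrier_mat m m" "B \<in> carrier_mat m' m'" by (auto simp: A_def B_def)
  have cp: "char_poly A = [:0, 1:] * char_poly B"
    unfolding A_def B_def m using rows by (intro char_poly_zero_row_sums) (simp add: m)
  have mz: "mean_zero {..<m} (apply_kernel {..<m} K g)" for g
    using sym rows by (intro kernel_mean_zero) auto
  have B0: "\<not> eigenvalue B 0"
  proof
    assume "eigenvalue B 0"
    then obtain w where w: "\<exists>i<m'. w i \<noteq> 0"
        "\<forall>i<m'. apply_kernel {..<m'} (\<lambda>i j. K (Suc i) (Suc j) - K 0 (Suc j)) w i = 0"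
      unfolding B_def eigenvalue_mat_iff by auto
    \<comment> \<open>Extended by 0 at index 0, the null vector has constant image
      \<open>K g\<close>; this image is also mean zero, so it vanishes. Then \<open>K h = 0\<close>
      for the centred \<open>h\<close>, and \<open>l > 0\<close> forces \<open>h = 0\<close>:
      \<open>g\<close> is constant with value \<open>g 0 = 0\<close>.\<close>
    define g where "g i = (case i of 0 \<Rightarrow> 0 | Suc j \<Rightarrow> w j)" for i
    have ak: "apply_kernel {..<m} K g i = (\<Sum>j<m'. K i (Suc j) * w j)" for i
      by (simp only: m sum.lessThan_Suc_shift) (simp add: g_def)
    have const: "apply_kernel {..<m} K g i = apply_kernel {..<m} K g 0" if "i < m" for i
      using that w(2)[rule_format, of "i - 1"]
      unfolding ak by (cases i) (auto simp: m left_diff_distrib sum_subtractf)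
    then have "(\<Sum>i<m. apply_kernel {..<m} K g i) = (\<Sum>i<m. apply_kernel {..<m} K g 0)"
      by (intro sum.cong refl const) simp
    then have "real m * apply_kernel {..<m} K g 0 = 0"
      unfolding mz by simp
    then have Kg: "apply_kernel {..<m} K g i = 0" if "i < m" for i
      unfolding const[OF that] using m by simp
    define a where "a = (\<Sum>i<m. g i) / m"
    define h where "h i = g i - a" for i
    have "mean_zero {..<m} h" using m by (simp add: h_def sum_subtractf a_def)
    moreover have "apply_kernel {..<m} K h i = 0" if "i < m" for i
      using Kg[OF that] rows[OF that]
      by (simp add: h_def right_diff_distrib sum_subtractf flip: sum_distrib_right)
    then have "kernel_form {..<m} K h = 0" by (intro sum.neutral) simp
    ultimately have "l * sq_norm {..<m} h \<le> 0" using bound by fastforce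
    then have "sq_norm {..<m} h = 0"
      using l by (metis mult_le_0_iff not_le sum_nonneg zero_le_power2 order_antisym)
    then have "h i = 0" if "i < m" for i using sq_norm_zero_imp[of "{..<m}" h i] that by simp
    then have "g (Suc i) = g 0" if "i < m'" for i using that m unfolding h_def by fastforce
    then show False using w(1) by (auto simp: g_def)
  qed
  have cp0: "char_poly A \<noteq> 0" using degree_monic_char_poly[OF carr(1)] by (metis m coeff_0 zero_neq_one)
  then have cpB: "char_poly B \<noteq> 0" using cp by auto
  define M where "M = proots (char_poly B)"
  have pr: "proots (char_poly A) = add_mset 0 M"
    unfolding cp M_def using cpB by (subst proots_mult) auto
  have roots: "k \<in># M \<Longrightarrow> l \<le> k" for k
  proof -
    assume "k \<in># M"
    then have "poly (char_poly B) k = 0" using cpB by (simp add: M_def)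
    then have k: "k \<noteq> 0" "eigenvalue A k"
      using B0 cp by (auto simp: eigenvalue_root_char_poly[OF carr(2)] eigenvalue_root_char_poly[OF carr(1)])
    then obtain g where g: "\<exists>i<m. g i \<noteq> 0" "\<And>i. i < m \<Longrightarrow> apply_kernel {..<m} K g i = k * g i"
      unfolding A_def eigenvalue_mat_iff by auto
    have "(\<Sum>i<m. k * g i) = (\<Sum>i<m. apply_kernel {..<m} K g i)"
      by (intro sum.cong refl g(2)[symmetric]) simp
    then have "mean_zero {..<m} (\<lambda>i. k * g i)" using mz by simp
    then have "mean_zero {..<m} g" using k by (simp flip: sum_distrib_left)
    note bound[OF this]
    also have "kernel_form {..<m} K g = (\<Sum>i<m. g i * (k * g i))"
      by (intro sum.cong refl) (simp add: g(2))
    also have "\<dots> = k * sq_norm {..<m} g" by (simp add: sum_distrib_left power2_eq_square algebra_simps)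
    finally have "l * sq_norm {..<m} g \<le> k * sq_norm {..<m} g" .
    moreover have "sq_norm {..<m} g \<noteq> 0" using g(1) sq_norm_zero_imp[of "{..<m}" g] by auto
    then have "sq_norm {..<m} g > 0" by (simp add: order_less_le sum_nonneg)
    ultimately show "l \<le> k" by simp
  qed
  have "eigenvalue A l"
    unfolding A_def eigenvalue_mat_iff using f sum.neutral[of "{..<m}" "\<lambda>i. (f i)\<^sup>2"]
    by (intro exI[of _ f]) fastforce
  \<comment> \<open>Being nonzero, \<open>l\<close> is not a root of the factor
    \<open>[:0, 1:]\<close>.\<close>
  then have "l \<in># M"
    using l cpB cp by (simp add: M_def eigenvalue_root_char_poly[OF carr(1)])
  then obtain M' where M': "M = add_mset l M'" by (metis insert_DiffM)
  have "sorted_list_of_multiset M = l # sorted_list_of_multiset M'"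
    using roots by (auto simp: M' intro!: insort_is_Cons)
  moreover have "sorted_list_of_multiset (add_mset 0 M) = 0 # sorted_list_of_multiset M"
    using roots l by (auto intro!: insort_is_Cons dest!: roots)
  ultimately show ?thesis
    unfolding second_smallest_eigenvalue_def A_def[symmetric] pr by simp
qed

lemma second_smallest_eigenvalue_eqI:
  fixes K :: "'i \<Rightarrow> 'i \<Rightarrow> real"
  assumes fin: "finite I"
    and sym: "\<And>i j. i \<in> I \<Longrightarrow> j \<in> I \<Longrightarrow> K i j = K j i"
    and rows: "\<And>i. i \<in> I \<Longrightarrow> (\<Sum>j\<in>I. K i j) = 0"
    and l: "l > 0"
    and f: "sq_norm I f \<noteq> 0" "\<And>i. i \<in> I \<Longrightarrow> apply_kernel I K f i = l * f i"
    and bound: "\<And>g. mean_zero I g \<Longrightarrow> l * sq_norm I g \<le> kernel_form I K g"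
  shows "second_smallest_eigenvalue (indexed_mat I K) = l"
proof -
  define m where "m = card I"
  define e where "e = from_nat_into I"
  have bij: "bij_betw e {..<m} I"
    unfolding e_def m_def using fin by (rule bij_betw_from_nat_into_finite)
  then have e: "e i \<in> I" if "i < m" for i using that by (auto simp: bij_betw_def)
  have re: "(\<Sum>i<m. h (e i)) = (\<Sum>i\<in>I. h i)" for h :: "'i \<Rightarrow> real"
    using bij by (rule sum.reindex_bij_betw)
  have inv: "inv_into {..<m} e (e i) = i" if "i < m" for i
    using bij that by (auto simp: bij_betw_def)
  have "second_smallest_eigenvalue (mat m m (\<lambda>(i, j). K (e i) (e j))) = l"
  proof (rule second_smallest_eigenvalue_eqI_nat[where f = "\<lambda>i. f (e i)"])
    show "K (e i) (e j) = K (e j) (e i)" if "i < m" "j < m" for i j using that e sym by blast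
    show "(\<Sum>j<m. K (e i) (e j)) = 0" if "i < m" for i using re[of "K (e i)"] rows e that by simp
    show "l > 0" by (fact l)
    show "(\<Sum>i<m. (f (e i))\<^sup>2) \<noteq> 0" using re[of "\<lambda>i. (f i)\<^sup>2"] f by simp
    show "(\<Sum>j<m. K (e i) (e j) * f (e j)) = l * f (e i)" if "i < m" for i
      using re[of "\<lambda>j. K (e i) j * f j"] f e that by simp
    fix g :: "nat \<Rightarrow> real"
    assume g: "(\<Sum>i<m. g i) = 0"
    define h where "h = g \<circ> inv_into {..<m} e"
    have h: "g i = h (e i)" if "i < m" for i using inv that by (simp add: h_def)
    have "(\<Sum>i<m. h (e i)) = (\<Sum>i<m. g i)" by (intro sum.cong refl) (simp add: h)
    then have "mean_zero I h" using g re[of h] by simp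
    from bound[OF this] have "l * (\<Sum>i<m. (h (e i))\<^sup>2) \<le>
        (\<Sum>i<m. h (e i) * (\<Sum>j<m. K (e i) (e j) * h (e j)))"
      by (simp add: re[of "\<lambda>j. K _ j * h j"] re[of "\<lambda>i. (h i)\<^sup>2"] re[of "\<lambda>i. h i * apply_kernel I K h i"])
    then show "l * (\<Sum>i<m. (g i)\<^sup>2) \<le> (\<Sum>i<m. g i * (\<Sum>j<m. K (e i) (e j) * g j))"
      by (simp add: h[symmetric] cong: sum.cong_simp)
  qed
  then show ?thesis by (simp add: indexed_mat_def m_def e_def)
qed

section \<open>The octopus inequality for at most three legs\<close>

abbreviation tr :: "'a \<Rightarrow> 'a \<Rightarrow> 'a \<Rightarrow> 'a" where
  "tr \<equiv> Transposition.transpose"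

abbreviation perms :: "'a set \<Rightarrow> ('a \<Rightarrow> 'a) set" where
  "perms V \<equiv> {\<sigma>. \<sigma> permutes V}"

lemma sum_perms_shift:
  assumes "\<pi> permutes V"
  shows "(\<Sum>\<sigma>\<in>perms V. h (\<pi> \<circ> \<sigma>)) = (\<Sum>\<sigma>\<in>perms V. h \<sigma>)"
  by (rule setum_permutations_compose_left[OF assms, symmetric])

lemma tr_permutes: "u \<in> V \<Longrightarrow> v \<in> V \<Longrightarrow> tr u v permutes V"
  by (rule permutes_swap_id)

text \<open>The three ways to factor one 3-cycle into transpositions of its points.\<close>

lemma tr_comp_tr:
  assumes "p \<noteq> q" "q \<noteq> r" "p \<noteq> r"
  shows "tr q r \<circ> tr p r = tr p q \<circ> tr q r" "tr p r \<circ> tr p q = tr p q \<circ> tr q r"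
  using assms by (auto simp: fun_eq_iff transpose_def)

text \<open>The matrix coefficient of \<open>f\<close> in the regular representation. In these
  numbers an octopus inequality is linear, with one unknown per group element.\<close>

definition autocorr :: "'a set \<Rightarrow> (('a \<Rightarrow> 'a) \<Rightarrow> real) \<Rightarrow> ('a \<Rightarrow> 'a) \<Rightarrow> real" where
  "autocorr V f \<pi> = (\<Sum>\<sigma>\<in>perms V. f \<sigma> * f (\<pi> \<circ> \<sigma>))"

definition shift_energy :: "'a set \<Rightarrow> (('a \<Rightarrow> 'a) \<Rightarrow> real) \<Rightarrow> ('a \<Rightarrow> 'a) \<Rightarrow> real" where
  "shift_energy V f \<pi> = (\<Sum>\<sigma>\<in>perms V. (f \<sigma> - f (\<pi> \<circ> \<sigma>))\<^sup>2)"

lemma autocorr_id: "autocorr V f id = sq_norm (perms V) f"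
  by (simp add: autocorr_def power2_eq_square)

lemma shift_energy_eq:
  assumes "\<pi> permutes V"
  shows "shift_energy V f \<pi> = 2 * (autocorr V f id - autocorr V f \<pi>)"
  using sum_perms_shift[OF assms, of "\<lambda>\<sigma>. (f \<sigma>)\<^sup>2"]
  by (simp add: shift_energy_def autocorr_def power2_eq_square algebra_simps
      sum.distrib sum_subtractf sum_distrib_left)

lemma autocorr_comp:
  assumes "\<pi> permutes V"
  shows "(\<Sum>\<sigma>\<in>perms V. f (\<pi> \<circ> \<sigma>) * f (\<rho> \<circ> \<sigma>)) = autocorr V f (\<rho> \<circ> inv_into UNIV \<pi>)"
proof -
  have "(\<rho> \<circ> inv_into UNIV \<pi>) \<circ> (\<pi> \<circ> \<sigma>) = \<rho> \<circ> \<sigma>" for \<sigma> :: "'a \<Rightarrow> 'a"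
    using assms by (metis comp_assoc comp_id permutes_inv_o(2))
  then show ?thesis
    using sum_perms_shift[OF assms, of "\<lambda>\<sigma>. f \<sigma> * f ((\<rho> \<circ> inv_into UNIV \<pi>) \<circ> \<sigma>)"]
    by (simp add: autocorr_def)
qed

lemma autocorr_tr_tr:
  assumes "u \<in> V" "v \<in> V"
  shows "(\<Sum>\<sigma>\<in>perms V. f (tr u v \<circ> \<sigma>) * f (\<rho> \<circ> \<sigma>)) = autocorr V f (\<rho> \<circ> tr u v)"
  by (simp add: autocorr_comp[OF tr_permutes[OF assms]])

text \<open>The summand is symmetric in its two factors, so either order of composition may be used;
  in a suitable order each of the three pairs composes to the same 3-cycle.\<close>

lemma autocorr_triangle:
  assumes "p \<in> V" "q \<in> V" "r \<in> V" "p \<noteq> q" "q \<noteq> r" "p \<noteq> r"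
  shows "(\<Sum>\<sigma>\<in>perms V. f (tr p q \<circ> \<sigma>) * f (tr q r \<circ> \<sigma>)) = autocorr V f (tr p q \<circ> tr q r)"
    "(\<Sum>\<sigma>\<in>perms V. f (tr p q \<circ> \<sigma>) * f (tr p r \<circ> \<sigma>)) = autocorr V f (tr p q \<circ> tr q r)"
    "(\<Sum>\<sigma>\<in>perms V. f (tr p r \<circ> \<sigma>) * f (tr q r \<circ> \<sigma>)) = autocorr V f (tr p q \<circ> tr q r)"
proof -
  have "(\<Sum>\<sigma>\<in>perms V. f (tr q r \<circ> \<sigma>) * f (tr p q \<circ> \<sigma>)) = autocorr V f (tr p q \<circ> tr q r)"
    using assms by (simp add: autocorr_tr_tr)
  then show "(\<Sum>\<sigma>\<in>perms V. f (tr p q \<circ> \<sigma>) * f (tr q r \<circ> \<sigma>)) = autocorr V f (tr p q \<circ> tr q r)"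
    by (simp add: mult.commute)
  show "(\<Sum>\<sigma>\<in>perms V. f (tr p q \<circ> \<sigma>) * f (tr p r \<circ> \<sigma>)) = autocorr V f (tr p q \<circ> tr q r)"
    "(\<Sum>\<sigma>\<in>perms V. f (tr p r \<circ> \<sigma>) * f (tr q r \<circ> \<sigma>)) = autocorr V f (tr p q \<circ> tr q r)"
    using assms by (simp_all add: autocorr_tr_tr tr_comp_tr)
qed

lemma autocorr_disjoint:
  assumes "r \<in> V" "s \<in> V"
  shows "(\<Sum>\<sigma>\<in>perms V. f (tr p q \<circ> \<sigma>) * f (tr r s \<circ> \<sigma>)) = autocorr V f (tr p q \<circ> tr r s)"
proof -
  have "(\<Sum>\<sigma>\<in>perms V. f (tr r s \<circ> \<sigma>) * f (tr p q \<circ> \<sigma>)) = autocorr V f (tr p q \<circ> tr r s)"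
    using assms by (simp add: autocorr_tr_tr)
  then show ?thesis by (simp add: mult.commute)
qed

lemma sum_tr_sq:
  assumes "u \<in> V" "v \<in> V"
  shows "(\<Sum>\<sigma>\<in>perms V. (f (tr u v \<circ> \<sigma>))\<^sup>2) = autocorr V f id"
  using sum_perms_shift[OF tr_permutes[OF assms], of "\<lambda>\<sigma>. (f \<sigma>)\<^sup>2"] by (simp add: autocorr_id)

text \<open>Cauchy-Schwarz in the form that passes from \<open>R^2 \<le> w^2\<close> to
  \<open>R \<le> w\<close>, with \<open>g = R f\<close>.\<close>

lemma inner_le_of_norm_le:
  fixes f g :: "'i \<Rightarrow> real"
  assumes "w > 0" "sq_norm S g \<le> w\<^sup>2 * sq_norm S f"
  shows "(\<Sum>s\<in>S. f s * g s) \<le> w * sq_norm S f"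
proof -
  have "0 \<le> (\<Sum>s\<in>S. (w * f s - g s)\<^sup>2)" by (simp add: sum_nonneg)
  also have "\<dots> = w\<^sup>2 * sq_norm S f - 2 * w * (\<Sum>s\<in>S. f s * g s) + sq_norm S g"
    by (simp add: power2_diff sum.distrib sum_subtractf sum_distrib_left power_mult_distrib algebra_simps)
  also have "\<dots> \<le> 2 * w * (w * sq_norm S f - (\<Sum>s\<in>S. f s * g s))"
    using assms(2) by (simp add: algebra_simps power2_eq_square)
  finally show ?thesis using assms(1) by (simp add: zero_le_mult_iff)
qed

text \<open>Half the difference of the two sides is
  \<open>w \<langle>f, f\<rangle> - \<langle>f, R f\<rangle>\<close>. In the squared norm of
  \<open>R f\<close> the three mixed products share one autocorrelation, with total coefficient
  \<open>2 a b (a + b) ((a + b) - a - b) = 0\<close>, and the squared coefficients add up to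
  \<open>w^2\<close>. So \<open>R f\<close> has exactly \<open>w\<close> times the norm of
  \<open>f\<close>.\<close>

lemma octopus_two_legs:
  fixes a b :: real
  assumes V: "k \<in> V" "i \<in> V" "j \<in> V" and dist: "distinct [k, i, j]" and ab: "a \<ge> 0" "b \<ge> 0"
  shows "a * b * shift_energy V f (tr i j) \<le>
    (a + b) * (a * shift_energy V f (tr k i) + b * shift_energy V f (tr k j))"
proof (cases "a = 0 \<or> b = 0")
  case True
  then show ?thesis using ab by (auto simp: shift_energy_def intro!: mult_nonneg_nonneg sum_nonneg)
next
  case False
  define N where "N = autocorr V f id"
  define w where "w = a\<^sup>2 + b\<^sup>2 + a * b"
  define R where "R \<sigma> = (a + b) * a * f (tr k i \<circ> \<sigma>) + (a + b) * b * f (tr k j \<circ> \<sigma>)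
    - a * b * f (tr i j \<circ> \<sigma>)" for \<sigma>
  have w: "w > 0" using False ab by (simp add: w_def add_pos_nonneg)
  have expand: "(\<Sum>\<sigma>\<in>S. (x * F \<sigma> + y * G \<sigma> - z * H \<sigma>)\<^sup>2) = x\<^sup>2 * (\<Sum>\<sigma>\<in>S. (F \<sigma>)\<^sup>2)
      + y\<^sup>2 * (\<Sum>\<sigma>\<in>S. (G \<sigma>)\<^sup>2) + z\<^sup>2 * (\<Sum>\<sigma>\<in>S. (H \<sigma>)\<^sup>2) + 2 * x * y * (\<Sum>\<sigma>\<in>S. F \<sigma> * G \<sigma>)
      - 2 * x * z * (\<Sum>\<sigma>\<in>S. F \<sigma> * H \<sigma>) - 2 * y * z * (\<Sum>\<sigma>\<in>S. G \<sigma> * H \<sigma>)"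
    for S :: "('a \<Rightarrow> 'a) set" and x y z :: real and F G H
    by (simp add: power2_eq_square algebra_simps sum.distrib sum_subtractf sum_distrib_left)
  have "sq_norm (perms V) R = w\<^sup>2 * N"
    unfolding R_def expand sum_tr_sq[OF V(1,2)] sum_tr_sq[OF V(1,3)] sum_tr_sq[OF V(2,3)]
    using autocorr_triangle[of k V i j f] V dist
    by (simp add: w_def N_def power2_eq_square algebra_simps)
  then have "(\<Sum>\<sigma>\<in>perms V. f \<sigma> * R \<sigma>) \<le> w * N"
    using inner_le_of_norm_le[OF w, of R "perms V" f] by (simp add: N_def autocorr_id)
  also have "(\<Sum>\<sigma>\<in>perms V. f \<sigma> * R \<sigma>) = (a + b) * a * autocorr V f (tr k i)
      + (a + b) * b * autocorr V f (tr k j) - a * b * autocorr V f (tr i j)"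
    by (simp add: R_def autocorr_def algebra_simps sum.distrib sum_subtractf sum_distrib_left)
  finally show ?thesis
    using V by (simp add: shift_energy_eq tr_permutes N_def w_def power2_eq_square algebra_simps)
qed

text \<open>Let \<open>G\<close> be the sum of the translates of \<open>f\<close> by the Klein four-group on \<open>{k, i, j, l}\<close>, and \<open>z\<close>
  a 3-cycle. The inequality is a quarter of \<open>\<langle>G, z G\<rangle> \<le> \<langle>G, G\<rangle>\<close>: the coset of \<open>z\<close> contains exactly
  one 3-cycle for each of the four triangles.\<close>

lemma autocorr_A4:
  assumes V: "k \<in> V" "i \<in> V" "j \<in> V" "l \<in> V" and dist: "distinct [k, i, j, l]"
  shows "autocorr V f (tr k i \<circ> tr i j) + autocorr V f (tr k i \<circ> tr i l)
      + autocorr V f (tr k j \<circ> tr j l) + autocorr V f (tr i j \<circ> tr j l)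
    \<le> autocorr V f id + autocorr V f (tr k i \<circ> tr j l) + autocorr V f (tr k j \<circ> tr i l)
      + autocorr V f (tr k l \<circ> tr i j)"
proof -
  define d1 where "d1 = tr k i \<circ> tr j l"
  define d2 where "d2 = tr k j \<circ> tr i l"
  define d3 where "d3 = tr k l \<circ> tr i j"
  define z where "z = tr k i \<circ> tr i j"
  note defs = d1_def d2_def d3_def z_def
  have perm: "d1 permutes V" "d2 permutes V" "d3 permutes V" "z permutes V"
    using V by (auto simp: defs intro!: permutes_compose tr_permutes)
  have klein: "d1 \<circ> d1 = id" "d2 \<circ> d2 = id" "d3 \<circ> d3 = id" "d1 \<circ> d2 = d3" "d2 \<circ> d1 = d3"
    "d1 \<circ> d3 = d2" "d3 \<circ> d1 = d2" "d2 \<circ> d3 = d1" "d3 \<circ> d2 = d1"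
    using dist by (auto simp: defs fun_eq_iff transpose_def)
  \<comment> \<open>Normality of the Klein group: conjugation by \<open>z\<close> permutes
    \<open>d1\<close>, \<open>d2\<close>, \<open>d3\<close> cyclically, so the translate of
    \<open>G\<close> by \<open>z\<close> is again invariant.\<close>
  have norm: "z \<circ> d1 = d3 \<circ> z" "z \<circ> d2 = d1 \<circ> z" "z \<circ> d3 = d2 \<circ> z"
    using dist by (auto simp: defs fun_eq_iff transpose_def)
  define G where "G \<sigma> = f \<sigma> + f (d1 \<circ> \<sigma>) + f (d2 \<circ> \<sigma>) + f (d3 \<circ> \<sigma>)" for \<sigma>
  have G_inv: "G (d1 \<circ> \<sigma>) = G \<sigma>" "G (d2 \<circ> \<sigma>) = G \<sigma>" "G (d3 \<circ> \<sigma>) = G \<sigma>" for \<sigma>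
    using klein by (simp_all add: G_def o_assoc)
  \<comment> \<open>Against an invariant \<open>H\<close> the four translates of \<open>f\<close>
    that make up \<open>G\<close> contribute equally.\<close>
  have proj: "(\<Sum>\<sigma>\<in>perms V. G \<sigma> * H \<sigma>) = 4 * (\<Sum>\<sigma>\<in>perms V. f \<sigma> * H \<sigma>)"
    if "\<And>\<sigma>. H (d1 \<circ> \<sigma>) = H \<sigma>" "\<And>\<sigma>. H (d2 \<circ> \<sigma>) = H \<sigma>" "\<And>\<sigma>. H (d3 \<circ> \<sigma>) = H \<sigma>" for H
    using sum_perms_shift[OF perm(1), of "\<lambda>\<sigma>. f \<sigma> * H \<sigma>"] sum_perms_shift[OF perm(2), of "\<lambda>\<sigma>. f \<sigma> * H \<sigma>"]
      sum_perms_shift[OF perm(3), of "\<lambda>\<sigma>. f \<sigma> * H \<sigma>"]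
    by (simp add: that G_def distrib_right sum.distrib)
  have "G (z \<circ> (d1 \<circ> \<sigma>)) = G (z \<circ> \<sigma>)" "G (z \<circ> (d2 \<circ> \<sigma>)) = G (z \<circ> \<sigma>)" "G (z \<circ> (d3 \<circ> \<sigma>)) = G (z \<circ> \<sigma>)" for \<sigma>
    using norm G_inv by (metis comp_assoc)+
  then have Gz: "(\<Sum>\<sigma>\<in>perms V. G \<sigma> * G (z \<circ> \<sigma>)) = 4 * (\<Sum>\<sigma>\<in>perms V. f \<sigma> * G (z \<circ> \<sigma>))"
    by (rule proj)
  have GG: "autocorr V G id = 4 * (\<Sum>\<sigma>\<in>perms V. f \<sigma> * G \<sigma>)"
    unfolding autocorr_def using proj[of G] G_inv by simp
  have "0 \<le> shift_energy V G z" by (simp add: shift_energy_def sum_nonneg)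
  then have "(\<Sum>\<sigma>\<in>perms V. f \<sigma> * G (z \<circ> \<sigma>)) \<le> (\<Sum>\<sigma>\<in>perms V. f \<sigma> * G \<sigma>)"
    using Gz GG by (simp add: shift_energy_eq[OF perm(4)] autocorr_def)
  moreover have "(\<Sum>\<sigma>\<in>perms V. f \<sigma> * G \<sigma>) = autocorr V f id + autocorr V f d1 + autocorr V f d2 + autocorr V f d3"
    by (simp add: G_def autocorr_def distrib_left sum.distrib)
  moreover have "(\<Sum>\<sigma>\<in>perms V. f \<sigma> * G (z \<circ> \<sigma>)) = autocorr V f z + autocorr V f (d1 \<circ> z)
      + autocorr V f (d2 \<circ> z) + autocorr V f (d3 \<circ> z)"
    by (simp add: G_def autocorr_def distrib_left sum.distrib comp_assoc)
  \<comment> \<open>Two of the 3-cycles in the coset come out as inverses of those in the statement;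
    inverse elements have equal autocorrelation.\<close>
  moreover have inv: "autocorr V f (tr q r \<circ> tr p q) = autocorr V f (tr p q \<circ> tr q r)"
    if "p \<in> V" "q \<in> V" "r \<in> V" "distinct [p, q, r]" for p q r
    using autocorr_triangle(1)[of p V q r f] autocorr_tr_tr[of p V q f "tr q r"] that by simp
  moreover have "d1 \<circ> z = tr j l \<circ> tr i j" "d2 \<circ> z = tr i l \<circ> tr k i" "d3 \<circ> z = tr k j \<circ> tr j l"
    using dist by (auto simp: defs fun_eq_iff transpose_def)
  ultimately show ?thesis
    using inv[of i j l] inv[of k i l] V dist by (simp flip: defs)
qed

text \<open>With \<open>s = a + b + c\<close> and \<open>w = s\<^sup>2 - a b - a c - b c\<close>, half the difference of the two sides is
  \<open>w \<langle>f, f\<rangle> - \<langle>f, R f\<rangle>\<close> for a combination \<open>R\<close> of transpositions. In \<open>R\<^sup>2\<close> all 3-cycles get the same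
  coefficient \<open>s a b c\<close> and all double transpositions its double with the opposite sign, so
  \<open>\<parallel>R f\<parallel> \<le> w \<parallel>f\<parallel>\<close> reduces to \<open>autocorr_A4\<close>.\<close>

lemma octopus_three_legs:
  fixes a b c :: real
  assumes V: "k \<in> V" "i \<in> V" "j \<in> V" "l \<in> V" and dist: "distinct [k, i, j, l]"
    and abc: "a \<ge> 0" "b \<ge> 0" "c \<ge> 0"
  shows "a * b * shift_energy V f (tr i j) + a * c * shift_energy V f (tr i l)
      + b * c * shift_energy V f (tr j l) \<le>
    (a + b + c) * (a * shift_energy V f (tr k i) + b * shift_energy V f (tr k j)
      + c * shift_energy V f (tr k l))"
proof (cases "a = 0 \<and> b = 0 \<and> c = 0")
  case False
  define N where "N = autocorr V f id"
  define c1 where "c1 = autocorr V f (tr k i \<circ> tr i j)"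
  define c2 where "c2 = autocorr V f (tr k i \<circ> tr i l)"
  define c3 where "c3 = autocorr V f (tr k j \<circ> tr j l)"
  define c4 where "c4 = autocorr V f (tr i j \<circ> tr j l)"
  define e1 where "e1 = autocorr V f (tr k i \<circ> tr j l)"
  define e2 where "e2 = autocorr V f (tr k j \<circ> tr i l)"
  define e3 where "e3 = autocorr V f (tr k l \<circ> tr i j)"
  define s where "s = a + b + c"
  define w where "w = s\<^sup>2 - a * b - a * c - b * c"
  define R where "R \<sigma> = s * a * f (tr k i \<circ> \<sigma>) + s * b * f (tr k j \<circ> \<sigma>) + s * c * f (tr k l \<circ> \<sigma>)
    - a * b * f (tr i j \<circ> \<sigma>) - a * c * f (tr i l \<circ> \<sigma>) - b * c * f (tr j l \<circ> \<sigma>)" for \<sigma>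
  have "w = a\<^sup>2 + b\<^sup>2 + c\<^sup>2 + a * b + a * c + b * c"
    by (simp add: w_def s_def power2_eq_square algebra_simps)
  moreover have "a\<^sup>2 + b\<^sup>2 + c\<^sup>2 > 0"
    using False by (metis add_nonneg_eq_0_iff add_nonneg_nonneg order_less_le power2_eq_iff_nonneg
        zero_eq_power2 zero_le_power2)
  moreover have "a * b \<ge> 0" "a * c \<ge> 0" "b * c \<ge> 0" using abc by simp_all
  ultimately have w: "w > 0" by linarith
  have expand: "(\<Sum>\<sigma>\<in>S. (x1 * F1 \<sigma> + x2 * F2 \<sigma> + x3 * F3 \<sigma> - x4 * F4 \<sigma> - x5 * F5 \<sigma> - x6 * F6 \<sigma>)\<^sup>2) =
      x1\<^sup>2 * (\<Sum>\<sigma>\<in>S. (F1 \<sigma>)\<^sup>2) + x2\<^sup>2 * (\<Sum>\<sigma>\<in>S. (F2 \<sigma>)\<^sup>2) + x3\<^sup>2 * (\<Sum>\<sigma>\<in>S. (F3 \<sigma>)\<^sup>2)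
      + x4\<^sup>2 * (\<Sum>\<sigma>\<in>S. (F4 \<sigma>)\<^sup>2) + x5\<^sup>2 * (\<Sum>\<sigma>\<in>S. (F5 \<sigma>)\<^sup>2) + x6\<^sup>2 * (\<Sum>\<sigma>\<in>S. (F6 \<sigma>)\<^sup>2)
      + 2 * x1 * x2 * (\<Sum>\<sigma>\<in>S. F1 \<sigma> * F2 \<sigma>) + 2 * x1 * x3 * (\<Sum>\<sigma>\<in>S. F1 \<sigma> * F3 \<sigma>)
      - 2 * x1 * x4 * (\<Sum>\<sigma>\<in>S. F1 \<sigma> * F4 \<sigma>) - 2 * x1 * x5 * (\<Sum>\<sigma>\<in>S. F1 \<sigma> * F5 \<sigma>)
      - 2 * x1 * x6 * (\<Sum>\<sigma>\<in>S. F1 \<sigma> * F6 \<sigma>) + 2 * x2 * x3 * (\<Sum>\<sigma>\<in>S. F2 \<sigma> * F3 \<sigma>)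
      - 2 * x2 * x4 * (\<Sum>\<sigma>\<in>S. F2 \<sigma> * F4 \<sigma>) - 2 * x2 * x5 * (\<Sum>\<sigma>\<in>S. F2 \<sigma> * F5 \<sigma>)
      - 2 * x2 * x6 * (\<Sum>\<sigma>\<in>S. F2 \<sigma> * F6 \<sigma>) - 2 * x3 * x4 * (\<Sum>\<sigma>\<in>S. F3 \<sigma> * F4 \<sigma>)
      - 2 * x3 * x5 * (\<Sum>\<sigma>\<in>S. F3 \<sigma> * F5 \<sigma>) - 2 * x3 * x6 * (\<Sum>\<sigma>\<in>S. F3 \<sigma> * F6 \<sigma>)
      + 2 * x4 * x5 * (\<Sum>\<sigma>\<in>S. F4 \<sigma> * F5 \<sigma>) + 2 * x4 * x6 * (\<Sum>\<sigma>\<in>S. F4 \<sigma> * F6 \<sigma>)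
      + 2 * x5 * x6 * (\<Sum>\<sigma>\<in>S. F5 \<sigma> * F6 \<sigma>)"
    for S :: "('a \<Rightarrow> 'a) set" and x1 x2 x3 x4 x5 x6 :: real and F1 F2 F3 F4 F5 F6
    by (simp add: power2_eq_square algebra_simps sum.distrib sum_subtractf sum_distrib_left)
  have d: "i \<noteq> k" "j \<noteq> k" "l \<noteq> k" "k \<noteq> i" "k \<noteq> j" "k \<noteq> l" "i \<noteq> j" "i \<noteq> l" "j \<noteq> l"
    using dist by auto
  have tri: "(\<Sum>\<sigma>\<in>perms V. f (tr k i \<circ> \<sigma>) * f (tr k j \<circ> \<sigma>)) = c1"
    "(\<Sum>\<sigma>\<in>perms V. f (tr k i \<circ> \<sigma>) * f (tr i j \<circ> \<sigma>)) = c1"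
    "(\<Sum>\<sigma>\<in>perms V. f (tr k j \<circ> \<sigma>) * f (tr i j \<circ> \<sigma>)) = c1"
    "(\<Sum>\<sigma>\<in>perms V. f (tr k i \<circ> \<sigma>) * f (tr k l \<circ> \<sigma>)) = c2"
    "(\<Sum>\<sigma>\<in>perms V. f (tr k i \<circ> \<sigma>) * f (tr i l \<circ> \<sigma>)) = c2"
    "(\<Sum>\<sigma>\<in>perms V. f (tr k l \<circ> \<sigma>) * f (tr i l \<circ> \<sigma>)) = c2"
    "(\<Sum>\<sigma>\<in>perms V. f (tr k j \<circ> \<sigma>) * f (tr k l \<circ> \<sigma>)) = c3"
    "(\<Sum>\<sigma>\<in>perms V. f (tr k j \<circ> \<sigma>) * f (tr j l \<circ> \<sigma>)) = c3"
    "(\<Sum>\<sigma>\<in>perms V. f (tr k l \<circ> \<sigma>) * f (tr j l \<circ> \<sigma>)) = c3"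
    "(\<Sum>\<sigma>\<in>perms V. f (tr i j \<circ> \<sigma>) * f (tr i l \<circ> \<sigma>)) = c4"
    "(\<Sum>\<sigma>\<in>perms V. f (tr i j \<circ> \<sigma>) * f (tr j l \<circ> \<sigma>)) = c4"
    "(\<Sum>\<sigma>\<in>perms V. f (tr i l \<circ> \<sigma>) * f (tr j l \<circ> \<sigma>)) = c4"
    unfolding c1_def c2_def c3_def c4_def by (rule autocorr_triangle; use V d in simp)+
  have dbl: "(\<Sum>\<sigma>\<in>perms V. f (tr k i \<circ> \<sigma>) * f (tr j l \<circ> \<sigma>)) = e1"
    "(\<Sum>\<sigma>\<in>perms V. f (tr k j \<circ> \<sigma>) * f (tr i l \<circ> \<sigma>)) = e2"
    "(\<Sum>\<sigma>\<in>perms V. f (tr k l \<circ> \<sigma>) * f (tr i j \<circ> \<sigma>)) = e3"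
    unfolding e1_def e2_def e3_def by (rule autocorr_disjoint; use V d in simp)+
  \<comment> \<open>The identity also falls short of \<open>w^2\<close>: the squared coefficients
    sum to \<open>w^2 - 2 s a b c\<close>, because the sum of the squares of \<open>a b\<close>,
    \<open>a c\<close>, \<open>b c\<close> is \<open>(a b + a c + b c)^2 - 2 s a b c\<close>. This
    supplies the term \<open>N\<close> in the bracket, without which \<open>autocorr_A4\<close>
    would not apply.\<close>
  have "sq_norm (perms V) R = w\<^sup>2 * N - 2 * s * a * b * c * (N + e1 + e2 + e3 - c1 - c2 - c3 - c4)"
    unfolding R_def expand tri dbl sum_tr_sq[OF V(1,2)] sum_tr_sq[OF V(1,3)] sum_tr_sq[OF V(1,4)]
      sum_tr_sq[OF V(2,3)] sum_tr_sq[OF V(2,4)] sum_tr_sq[OF V(3,4)] N_def[symmetric]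
    unfolding w_def s_def by (simp add: power2_eq_square algebra_simps)
  also have "\<dots> \<le> w\<^sup>2 * N"
    using autocorr_A4[OF V dist, of f] abc
    unfolding N_def[symmetric] c1_def[symmetric] c2_def[symmetric] c3_def[symmetric] c4_def[symmetric]
      e1_def[symmetric] e2_def[symmetric] e3_def[symmetric] s_def
    by (simp add: mult_nonneg_nonneg)
  finally have "(\<Sum>\<sigma>\<in>perms V. f \<sigma> * R \<sigma>) \<le> w * N"
    using inner_le_of_norm_le[OF w, of R "perms V" f] by (simp add: N_def autocorr_id)
  also have "(\<Sum>\<sigma>\<in>perms V. f \<sigma> * R \<sigma>) = s * a * autocorr V f (tr k i)
      + s * b * autocorr V f (tr k j) + s * c * autocorr V f (tr k l) - a * b * autocorr V f (tr i j)
      - a * c * autocorr V f (tr i l) - b * c * autocorr V f (tr j l)"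
    by (simp add: R_def autocorr_def algebra_simps sum.distrib sum_subtractf sum_distrib_left)
  finally show ?thesis
    using V by (simp add: shift_energy_eq tr_permutes N_def w_def s_def power2_eq_square algebra_simps)
qed simp

section \<open>Laplacians as quadratic forms\<close>

text \<open>The sums below run over ordered pairs; \<open>walk_form\<close> and \<open>interchange_form\<close> are normalised to be
  the quadratic forms of the two Laplacians. Diagonal weights \<open>c u u\<close> never contribute.\<close>

definition walk_op :: "'a set \<Rightarrow> ('a \<Rightarrow> 'a \<Rightarrow> real) \<Rightarrow> ('a \<Rightarrow> real) \<Rightarrow> 'a \<Rightarrow> real" where
  "walk_op V c g x = (\<Sum>v\<in>V. c x v * (g x - g v))"

definition walk_form :: "'a set \<Rightarrow> ('a \<Rightarrow> 'a \<Rightarrow> real) \<Rightarrow> ('a \<Rightarrow> real) \<Rightarrow> real" where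
  "walk_form V c g = (\<Sum>u\<in>V. \<Sum>v\<in>V. c u v * (g u - g v)\<^sup>2) / 2"

definition interchange_op :: "'a set \<Rightarrow> ('a \<Rightarrow> 'a \<Rightarrow> real) \<Rightarrow> (('a \<Rightarrow> 'a) \<Rightarrow> real) \<Rightarrow> ('a \<Rightarrow> 'a) \<Rightarrow> real" where
  "interchange_op V c f \<sigma> = (\<Sum>u\<in>V. \<Sum>v\<in>V. c u v * (f \<sigma> - f (tr u v \<circ> \<sigma>))) / 2"

definition interchange_form :: "'a set \<Rightarrow> ('a \<Rightarrow> 'a \<Rightarrow> real) \<Rightarrow> (('a \<Rightarrow> 'a) \<Rightarrow> real) \<Rightarrow> real" where
  "interchange_form V c f = (\<Sum>u\<in>V. \<Sum>v\<in>V. c u v * shift_energy V f (tr u v)) / 4"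

text \<open>An order-free form of the interchange Laplacian for arbitrary vertex sets, whereas the
  original is tied to \<open>{1..n}\<close>.\<close>

definition interchange_kernel :: "'a set \<Rightarrow> ('a \<Rightarrow> 'a \<Rightarrow> real) \<Rightarrow> ('a \<Rightarrow> 'a) \<Rightarrow> ('a \<Rightarrow> 'a) \<Rightarrow> real" where
  "interchange_kernel V c \<sigma> \<sigma>' =
    (\<Sum>u\<in>V. \<Sum>v\<in>V. c u v * (of_bool (\<sigma>' = \<sigma>) - of_bool (\<sigma>' = tr u v \<circ> \<sigma>))) / 2"

text \<open>Every lower bound for the random-walk form on mean-zero functions is one for the interchange
  form: the spectral gap inequality, stated without eigenvalues.\<close>

definition aldous :: "'a set \<Rightarrow> ('a \<Rightarrow> 'a \<Rightarrow> real) \<Rightarrow> bool" where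
  "aldous V c \<longleftrightarrow> (\<forall>\<mu>. (\<forall>g. mean_zero V g \<longrightarrow> \<mu> * sq_norm V g \<le> walk_form V c g) \<longrightarrow>
    (\<forall>f. mean_zero (perms V) f \<longrightarrow> \<mu> * sq_norm (perms V) f \<le> interchange_form V c f))"

lemma sum_swap3:
  "(\<Sum>s\<in>S. \<Sum>u\<in>A. \<Sum>v\<in>B. h s u v) = (\<Sum>u\<in>A. \<Sum>v\<in>B. \<Sum>s\<in>S. h s u v)"
  by (subst sum.swap, intro sum.cong refl, rule sum.swap)

lemma sq_norm_pos:
  fixes f :: "'i \<Rightarrow> real"
  assumes "finite I" "i \<in> I" "f i \<noteq> 0"
  shows "sq_norm I f > 0"
  using assms sq_norm_zero_imp[of I f i] by (simp add: order_less_le sum_nonneg) metis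

lemma sum_walk_op:
  assumes sym: "\<And>u v. u \<in> V \<Longrightarrow> v \<in> V \<Longrightarrow> c u v = c v u"
  shows "(\<Sum>x\<in>V. g x * walk_op V c g x) = walk_form V c g"
proof -
  have "(\<Sum>x\<in>V. g x * walk_op V c g x) = (\<Sum>x\<in>V. \<Sum>v\<in>V. c x v * g x * (g x - g v))"
    by (simp add: walk_op_def sum_distrib_left mult_ac)
  moreover have "\<dots> = (\<Sum>x\<in>V. \<Sum>v\<in>V. c x v * g v * (g v - g x))"
    by (subst sum.swap) (intro sum.cong refl, simp add: sym)
  moreover have "(\<Sum>x\<in>V. \<Sum>v\<in>V. c x v * g x * (g x - g v)) + (\<Sum>x\<in>V. \<Sum>v\<in>V. c x v * g v * (g v - g x))
      = (\<Sum>x\<in>V. \<Sum>v\<in>V. c x v * (g x - g v)\<^sup>2)"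
    unfolding sum.distrib[symmetric] by (intro sum.cong refl) (simp add: power2_eq_square algebra_simps)
  ultimately show ?thesis by (simp add: walk_form_def)
qed

lemma sum_interchange_op:
  "(\<Sum>\<sigma>\<in>perms V. f \<sigma> * interchange_op V c f \<sigma>) = interchange_form V c f"
proof -
  have inner: "(\<Sum>\<sigma>\<in>perms V. f \<sigma> * (f \<sigma> - f (tr u v \<circ> \<sigma>))) = shift_energy V f (tr u v) / 2"
    if "u \<in> V" "v \<in> V" for u v
    by (simp add: shift_energy_eq tr_permutes that autocorr_def comp_def right_diff_distrib sum_subtractf)
  have "(\<Sum>\<sigma>\<in>perms V. f \<sigma> * interchange_op V c f \<sigma>) =
      (\<Sum>\<sigma>\<in>perms V. \<Sum>u\<in>V. \<Sum>v\<in>V. c u v * (f \<sigma> * (f \<sigma> - f (tr u v \<circ> \<sigma>)))) / 2"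
    by (simp add: interchange_op_def sum_distrib_left sum_divide_distrib mult_ac)
  also have "\<dots> = (\<Sum>u\<in>V. \<Sum>v\<in>V. c u v * (\<Sum>\<sigma>\<in>perms V. f \<sigma> * (f \<sigma> - f (tr u v \<circ> \<sigma>)))) / 2"
    by (subst sum_swap3) (simp only: sum_distrib_left)
  also have "\<dots> = (\<Sum>u\<in>V. \<Sum>v\<in>V. c u v * (shift_energy V f (tr u v) / 2)) / 2"
    by (intro arg_cong[where f = "\<lambda>x. x / 2"] sum.cong refl) (simp add: inner)
  also have "\<dots> = interchange_form V c f"
    by (simp add: interchange_form_def sum_divide_distrib)
  finally show ?thesis .
qed

lemma apply_interchange_kernel:
  assumes "finite V" "\<sigma> permutes V"
  shows "apply_kernel (perms V) (interchange_kernel V c) f \<sigma> = interchange_op V c f \<sigma>"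
proof -
  have fin: "finite (perms V)" using assms(1) by (rule finite_permutations)
  have pick: "(\<Sum>\<sigma>'\<in>perms V. of_bool (\<sigma>' = \<tau>) * f \<sigma>') = f \<tau>" if "\<tau> permutes V" for \<tau>
  proof -
    have "(\<Sum>\<sigma>'\<in>perms V. of_bool (\<sigma>' = \<tau>) * f \<sigma>') = (\<Sum>\<sigma>'\<in>perms V. if \<sigma>' = \<tau> then f \<sigma>' else 0)"
      by (intro sum.cong) auto
    then show ?thesis using that fin by simp
  qed
  have "apply_kernel (perms V) (interchange_kernel V c) f \<sigma> = (\<Sum>\<sigma>'\<in>perms V. \<Sum>u\<in>V. \<Sum>v\<in>V.
      c u v * (of_bool (\<sigma>' = \<sigma>) * f \<sigma>' - of_bool (\<sigma>' = tr u v \<circ> \<sigma>) * f \<sigma>')) / 2"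
    unfolding interchange_kernel_def times_divide_eq_left sum_distrib_right sum_divide_distrib
    by (intro sum.cong refl) (simp add: algebra_simps)
  also have "\<dots> = (\<Sum>u\<in>V. \<Sum>v\<in>V. c u v * ((\<Sum>\<sigma>'\<in>perms V. of_bool (\<sigma>' = \<sigma>) * f \<sigma>')
      - (\<Sum>\<sigma>'\<in>perms V. of_bool (\<sigma>' = tr u v \<circ> \<sigma>) * f \<sigma>'))) / 2"
    unfolding sum_subtractf[symmetric] sum_distrib_left
    by (subst sum_swap3) (rule refl)
  also have "\<dots> = interchange_op V c f \<sigma>"
    unfolding interchange_op_def using assms(2)
    by (intro arg_cong[where f = "\<lambda>x. x / 2"] sum.cong refl)
      (simp only: pick permutes_compose tr_permutes)
  finally show ?thesis .
qed

lemma interchange_kernel_sym: "interchange_kernel V c \<sigma> \<sigma>' = interchange_kernel V c \<sigma>' \<sigma>"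
proof -
  have eq: "\<sigma>' = tr u v \<circ> \<sigma> \<longleftrightarrow> \<sigma> = tr u v \<circ> \<sigma>'" for u v
    by (metis comp_assoc id_comp transpose_comp_involutory)
  have "(of_bool (\<sigma>' = \<sigma>) - of_bool (\<sigma>' = tr u v \<circ> \<sigma>) :: real)
      = of_bool (\<sigma> = \<sigma>') - of_bool (\<sigma> = tr u v \<circ> \<sigma>')" for u v
    using eq[of u v] by auto
  then show ?thesis unfolding interchange_kernel_def by presburger
qed

lemma interchange_kernel_rows:
  assumes "finite V" "\<sigma> permutes V"
  shows "(\<Sum>\<sigma>'\<in>perms V. interchange_kernel V c \<sigma> \<sigma>') = 0"
  using apply_interchange_kernel[OF assms, of c "\<lambda>_. 1"] by (simp add: interchange_op_def)

lemma interchange_kernel_form: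
  assumes "finite V"
  shows "kernel_form (perms V) (interchange_kernel V c) f = interchange_form V c f"
  unfolding sum_interchange_op[symmetric]
  by (intro sum.cong refl) (simp add: apply_interchange_kernel assms)

text \<open>A transposition moves \<open>x\<close> only if \<open>x\<close> is one of its two
  points; each such transposition occurs as two ordered pairs, which cancels the half. This is the
  link between the two processes, used both for lifting walk functions and for marginals.\<close>

lemma sum_transpositions_at:
  fixes c :: "'a \<Rightarrow> 'a \<Rightarrow> real"
  assumes fin: "finite V" and x: "x \<in> V" and sym: "\<And>u v. u \<in> V \<Longrightarrow> v \<in> V \<Longrightarrow> c u v = c v u"
  shows "(\<Sum>u\<in>V. \<Sum>v\<in>V. c u v * (g x - g (tr u v x))) / 2 = walk_op V c g x"
proof -
  have "c u v * (g x - g (tr u v x)) = (if u = x then c x v * (g x - g v) else 0)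
      + (if v = x then c u x * (g x - g u) else 0)" for u v
    by (auto simp: transpose_def)
  moreover have "(\<Sum>v\<in>V. if u = x then c x v * (g x - g v) else 0) = (if u = x then walk_op V c g x else 0)" for u
    by (simp add: walk_op_def)
  moreover have "(\<Sum>v\<in>V. if v = x then c u x * (g x - g u) else 0) = c u x * (g x - g u)" for u
    using fin x by simp
  moreover have "(\<Sum>u\<in>V. c u x * (g x - g u)) = walk_op V c g x"
    unfolding walk_op_def by (intro sum.cong refl) (simp add: sym x)
  ultimately show ?thesis using fin x by (simp add: sum.distrib)
qed

lemma interchange_op_one_point:
  assumes "finite V" "y \<in> V" "\<sigma> permutes V" "\<And>u v. u \<in> V \<Longrightarrow> v \<in> V \<Longrightarrow> c u v = c v u"
  shows "interchange_op V c (\<lambda>\<sigma>. g (\<sigma> y)) \<sigma> = walk_op V c g (\<sigma> y)"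
  using sum_transpositions_at[of V "\<sigma> y" c g] assms
  by (simp add: interchange_op_def permutes_in_image)

section \<open>Marginals and cosets\<close>

text \<open>The adjoint of the lift that sends \<open>g\<close> to the function
  \<open>\<lambda>\<sigma>. g (\<sigma> y)\<close>.\<close>

definition marginal :: "'a set \<Rightarrow> (('a \<Rightarrow> 'a) \<Rightarrow> real) \<Rightarrow> 'a \<Rightarrow> 'a \<Rightarrow> real" where
  "marginal V f y x = (\<Sum>\<sigma>\<in>perms V. if \<sigma> y = x then f \<sigma> else 0)"

lemma sum_marginal:
  assumes "finite V" "y \<in> V"
  shows "(\<Sum>x\<in>V. marginal V f y x) = (\<Sum>\<sigma>\<in>perms V. f \<sigma>)"
  unfolding marginal_def
  using assms by (subst sum.swap) (auto simp: permutes_in_image intro!: sum.cong)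

text \<open>The lift intertwines the two operators, hence so does its adjoint. Concretely,
  translating by \<open>tr u v\<close> turns the condition \<open>\<sigma> y = x\<close> into
  \<open>\<sigma> y = tr u v x\<close>.\<close>

lemma marginal_eigen:
  assumes fin: "finite V" and x: "x \<in> V" and sym: "\<And>u v. u \<in> V \<Longrightarrow> v \<in> V \<Longrightarrow> c u v = c v u"
    and eigen: "\<And>\<sigma>. \<sigma> permutes V \<Longrightarrow> interchange_op V c f \<sigma> = l * f \<sigma>"
  shows "walk_op V c (marginal V f y) x = l * marginal V f y x"
proof -
  have shift: "(\<Sum>\<sigma>\<in>perms V. if \<sigma> y = x then f (tr u v \<circ> \<sigma>) else 0) = marginal V f y (tr u v x)"
    if "u \<in> V" "v \<in> V" for u v
  proof -
    have "tr u v a = tr u v x \<longleftrightarrow> a = x" for a by (metis transpose_involutory)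
    then show ?thesis
      using sum_perms_shift[OF tr_permutes[OF that], of "\<lambda>\<sigma>. if \<sigma> y = tr u v x then f \<sigma> else 0"]
      by (simp add: marginal_def)
  qed
  have "l * marginal V f y x = (\<Sum>\<sigma>\<in>perms V. if \<sigma> y = x then interchange_op V c f \<sigma> else 0)"
    by (auto simp: marginal_def sum_distrib_left eigen intro!: sum.cong)
  also have "\<dots> = (\<Sum>\<sigma>\<in>perms V. \<Sum>u\<in>V. \<Sum>v\<in>V. c u v *
      ((if \<sigma> y = x then f \<sigma> else 0) - (if \<sigma> y = x then f (tr u v \<circ> \<sigma>) else 0))) / 2"
    unfolding sum_divide_distrib by (intro sum.cong refl) (simp add: interchange_op_def sum_divide_distrib)
  also have "\<dots> = (\<Sum>u\<in>V. \<Sum>v\<in>V. c u v * (marginal V f y x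
      - (\<Sum>\<sigma>\<in>perms V. if \<sigma> y = x then f (tr u v \<circ> \<sigma>) else 0))) / 2"
    unfolding marginal_def sum_subtractf[symmetric] sum_distrib_left
    by (subst sum_swap3) (rule refl)
  also have "\<dots> = (\<Sum>u\<in>V. \<Sum>v\<in>V. c u v * (marginal V f y x - marginal V f y (tr u v x))) / 2"
    by (intro arg_cong[where f = "\<lambda>x. x / 2"] sum.cong refl) (simp add: shift)
  also have "\<dots> = walk_op V c (marginal V f y) x"
    by (rule sum_transpositions_at[OF fin x sym])
  finally show ?thesis by simp
qed

text \<open>The coset representative \<open>tr y k\<close> acts on the right and the process on the
  left. Hence transpositions avoiding \<open>k\<close> preserve each coset and act on it as on the
  permutations of \<open>V - {k}\<close>.\<close>

lemma bij_betw_perms_coset: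
  assumes "k \<in> V" "y \<in> V"
  shows "bij_betw (\<lambda>\<pi>. \<pi> \<circ> tr y k) (perms (V - {k})) {\<sigma> \<in> perms V. \<sigma> y = k}"
proof -
  have perm: "tr y k permutes V" using assms by (simp add: tr_permutes)
  have "\<sigma> \<circ> tr y k permutes V - {k}" if "\<sigma> permutes V" "\<sigma> y = k" for \<sigma>
    by (rule permutes_superset[OF permutes_compose[OF perm that(1)]]) (auto simp: that(2))
  moreover have "\<pi> \<circ> tr y k permutes V" "(\<pi> \<circ> tr y k) y = k" if "\<pi> permutes V - {k}" for \<pi>
  proof -
    show "\<pi> \<circ> tr y k permutes V"
      by (rule permutes_compose[OF perm permutes_subset[OF that]]) simp
    show "(\<pi> \<circ> tr y k) y = k" by (simp add: permutes_not_in[OF that])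
  qed
  ultimately show ?thesis
    by (intro bij_betw_byWitness[where f' = "\<lambda>\<sigma>. \<sigma> \<circ> tr y k"]) (auto simp: comp_assoc)
qed

lemma marginal_coset:
  assumes "finite V" "k \<in> V" "y \<in> V"
  shows "marginal V h y k = (\<Sum>\<pi>\<in>perms (V - {k}). h (\<pi> \<circ> tr y k))"
proof -
  have "finite (perms V)" using assms(1) by (rule finite_permutations)
  then have "marginal V h y k = (\<Sum>\<sigma>\<in>{\<sigma> \<in> perms V. \<sigma> y = k}. h \<sigma>)"
    unfolding marginal_def by (subst sum.inter_filter) (assumption, rule refl)
  also have "\<dots> = (\<Sum>\<pi>\<in>perms (V - {k}). h (\<pi> \<circ> tr y k))"
    by (rule sum.reindex_bij_betw[OF bij_betw_perms_coset[OF assms(2,3)], symmetric])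
  finally show ?thesis .
qed

lemma sum_perms_cosets:
  fixes h :: "('a \<Rightarrow> 'a) \<Rightarrow> real"
  assumes fin: "finite V" and k: "k \<in> V"
  shows "(\<Sum>\<sigma>\<in>perms V. h \<sigma>) = (\<Sum>y\<in>V. \<Sum>\<pi>\<in>perms (V - {k}). h (\<pi> \<circ> tr y k))"
proof -
  have "(\<Sum>y\<in>V. if \<sigma> y = k then h \<sigma> else 0) = h \<sigma>" if "\<sigma> permutes V" for \<sigma>
  proof -
    define y0 where "y0 = inv_into UNIV \<sigma> k"
    have "y0 \<in> V" using that k by (simp add: y0_def permutes_in_image[OF permutes_inv])
    moreover have "\<sigma> y = k \<longleftrightarrow> y = y0" for y
      using permutes_inverses[OF that] by (auto simp: y0_def)
    ultimately show ?thesis using fin by simp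
  qed
  then have "(\<Sum>\<sigma>\<in>perms V. h \<sigma>) = (\<Sum>\<sigma>\<in>perms V. \<Sum>y\<in>V. if \<sigma> y = k then h \<sigma> else 0)"
    by (intro sum.cong) auto
  also have "\<dots> = (\<Sum>y\<in>V. marginal V h y k)" unfolding marginal_def by (rule sum.swap)
  also have "\<dots> = (\<Sum>y\<in>V. \<Sum>\<pi>\<in>perms (V - {k}). h (\<pi> \<circ> tr y k))"
    by (intro sum.cong refl marginal_coset fin k)
  finally show ?thesis .
qed

section \<open>Eliminating a vertex\<close>

lemma walk_form_nonneg:
  assumes "\<And>u v. u \<in> V \<Longrightarrow> v \<in> V \<Longrightarrow> c u v \<ge> 0"
  shows "walk_form V c g \<ge> 0"
  using assms by (auto simp: walk_form_def intro!: sum_nonneg)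

lemma shift_energy_nonneg: "shift_energy V f \<pi> \<ge> 0"
  by (simp add: shift_energy_def sum_nonneg)

lemma shift_energy_id [simp]: "shift_energy V f id = 0"
  by (simp add: shift_energy_def)

lemma sum_split_vertex:
  fixes F :: "'a \<Rightarrow> 'a \<Rightarrow> real"
  assumes fin: "finite V" and k: "k \<in> V" and "F k k = 0" and sym: "\<And>u. u \<in> V \<Longrightarrow> F u k = F k u"
  shows "(\<Sum>u\<in>V. \<Sum>v\<in>V. F u v) =
    2 * (\<Sum>u\<in>V - {k}. F k u) + (\<Sum>u\<in>V - {k}. \<Sum>v\<in>V - {k}. F u v)"
proof -
  have "(\<Sum>u\<in>V. \<Sum>v\<in>V. F u v) = (\<Sum>v\<in>V. F k v) + (\<Sum>u\<in>V - {k}. \<Sum>v\<in>V. F u v)"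
    by (rule sum.remove[OF fin k])
  also have "(\<Sum>v\<in>V. F k v) = (\<Sum>u\<in>V - {k}. F k u)"
    using sum.remove[OF fin k, of "F k"] assms(3) by simp
  also have "(\<Sum>u\<in>V - {k}. \<Sum>v\<in>V. F u v) = (\<Sum>u\<in>V - {k}. F u k + (\<Sum>v\<in>V - {k}. F u v))"
    by (intro sum.cong refl sum.remove[OF fin k])
  also have "\<dots> = (\<Sum>u\<in>V - {k}. F k u) + (\<Sum>u\<in>V - {k}. \<Sum>v\<in>V - {k}. F u v)"
    unfolding sum.distrib using sym by (intro arg_cong2[where f = "(+)"] sum.cong refl) auto
  finally show ?thesis by simp
qed

text \<open>The weights on \<open>V - {k}\<close> whose walk form is the form on \<open>V\<close> of the extension that is harmonic
  at \<open>k\<close>. If \<open>k\<close> is isolated, \<open>x / 0 = 0\<close> gives the right weights.\<close>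

definition star_mesh :: "'a set \<Rightarrow> 'a \<Rightarrow> ('a \<Rightarrow> 'a \<Rightarrow> real) \<Rightarrow> 'a \<Rightarrow> 'a \<Rightarrow> real" where
  "star_mesh V k c u v = c u v + c k u * c k v / (\<Sum>w\<in>V - {k}. c k w)"

text \<open>The formula for a variance through pairwise differences, for the probability weights
  \<open>a u / C\<close> with mean \<open>m\<close>. If \<open>C = 0\<close>, all weights vanish and
  both sides are 0.\<close>

lemma star_mesh_energy:
  fixes a g :: "'a \<Rightarrow> real"
  assumes fin: "finite W" and nonneg: "\<And>u. u \<in> W \<Longrightarrow> a u \<ge> 0"
  defines "C \<equiv> \<Sum>u\<in>W. a u"
  defines "m \<equiv> (\<Sum>u\<in>W. a u * g u) / C"
  shows "(\<Sum>u\<in>W. \<Sum>v\<in>W. a u * a v / C * (g u - g v)\<^sup>2) = 2 * (\<Sum>u\<in>W. a u * (m - g u)\<^sup>2)"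
proof (cases "C = 0")
  case True
  then have "a u = 0" if "u \<in> W" for u
    using that nonneg fin by (simp add: C_def sum_nonneg_eq_0_iff)
  then show ?thesis by simp
next
  case False
  define S where "S = (\<Sum>u\<in>W. a u * g u)"
  define Q where "Q = (\<Sum>u\<in>W. a u * (g u)\<^sup>2)"
  have "(\<Sum>u\<in>W. \<Sum>v\<in>W. a u * a v / C * (g u - g v)\<^sup>2) =
      (\<Sum>u\<in>W. \<Sum>v\<in>W. a u * (g u)\<^sup>2 * a v + a u * (a v * (g v)\<^sup>2) - 2 * (a u * g u) * (a v * g v)) / C"
    unfolding sum_divide_distrib by (intro sum.cong refl) (simp add: power2_eq_square field_simps False)
  also have "\<dots> = (2 * C * Q - 2 * S\<^sup>2) / C"
    by (simp add: sum.distrib sum_subtractf flip: sum_distrib_left sum_distrib_right)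
      (simp add: C_def[symmetric] Q_def S_def[symmetric] power2_eq_square flip: sum_distrib_left sum_distrib_right)
  also have "\<dots> = 2 * (m\<^sup>2 * C - 2 * m * S + Q)"
    using False by (simp add: m_def S_def[symmetric] power2_eq_square field_simps)
  also have "m\<^sup>2 * C - 2 * m * S + Q = (\<Sum>u\<in>W. a u * (m - g u)\<^sup>2)"
    by (simp add: C_def Q_def S_def sum_distrib_left power2_eq_square algebra_simps sum.distrib sum_subtractf)
  finally show ?thesis .
qed

text \<open>The harmonic extension \<open>G\<close> takes the value \<open>a\<close> at
  \<open>k\<close>, so it has sum \<open>a\<close> and must be recentred before the bound applies.
  Recentring leaves the form unchanged, and the squared norm of \<open>G - m\<close> exceeds that of
  \<open>g\<close> by \<open>a^2 (1 - 1 / card V) \<ge> 0\<close>.\<close>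

lemma star_mesh_gap:
  assumes fin: "finite V" and k: "k \<in> V"
    and sym: "\<And>u v. u \<in> V \<Longrightarrow> v \<in> V \<Longrightarrow> c u v = c v u"
    and nonneg: "\<And>u v. u \<in> V \<Longrightarrow> v \<in> V \<Longrightarrow> c u v \<ge> 0"
    and bound: "\<And>g. mean_zero V g \<Longrightarrow> \<mu> * sq_norm V g \<le> walk_form V c g"
    and g: "mean_zero (V - {k}) g"
  shows "\<mu> * sq_norm (V - {k}) g \<le> walk_form (V - {k}) (star_mesh V k c) g"
proof -
  let ?W = "V - {k}"
  define a where "a = (\<Sum>u\<in>?W. c k u * g u) / (\<Sum>u\<in>?W. c k u)"
  define G where "G = g(k := a)"
  define m where "m = a / card V"
  have V: "card V \<ge> 1" using fin k by (metis card_0_eq empty_iff less_one not_le)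
  have G: "G u = g u" if "u \<in> ?W" for u using that by (auto simp: G_def)
  have sumG: "(\<Sum>u\<in>V. G u) = a"
    using sum.remove[OF fin k, of G] g G by (simp add: G_def)
  have sqG: "sq_norm V G = a\<^sup>2 + sq_norm ?W g"
    using sum.remove[OF fin k, of "\<lambda>u. (G u)\<^sup>2"] G by (simp add: G_def)
  have "mean_zero V (\<lambda>u. G u - m)"
    using V by (simp add: sum_subtractf sumG m_def)
  from bound[OF this] have le: "\<mu> * sq_norm V (\<lambda>u. G u - m) \<le> walk_form V c G"
    by (simp add: walk_form_def)
  have "sq_norm V (\<lambda>u. G u - m) = sq_norm V G - 2 * m * (\<Sum>u\<in>V. G u) + card V * m\<^sup>2"
    by (simp add: power2_diff sum.distrib sum_subtractf sum_distrib_left sum_distrib_right mult_ac)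
  also have "\<dots> = sq_norm ?W g + a\<^sup>2 * (1 - 1 / card V)"
    using V unfolding sumG sqG m_def by (simp add: power2_eq_square field_simps)
  finally have ge: "sq_norm ?W g \<le> sq_norm V (\<lambda>u. G u - m)"
    using V by simp
  have "2 * walk_form V c G = 2 * (\<Sum>u\<in>?W. c k u * (a - g u)\<^sup>2) + (\<Sum>u\<in>?W. \<Sum>v\<in>?W. c u v * (g u - g v)\<^sup>2)"
    unfolding walk_form_def using G
    by (subst sum_split_vertex[OF fin k]) (auto simp: sym[OF _ k] power2_commute G_def intro!: sum.cong)
  also have "2 * (\<Sum>u\<in>?W. c k u * (a - g u)\<^sup>2) =
      (\<Sum>u\<in>?W. \<Sum>v\<in>?W. c k u * c k v / (\<Sum>w\<in>?W. c k w) * (g u - g v)\<^sup>2)"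
    unfolding a_def using fin nonneg k by (subst star_mesh_energy) auto
  also have "\<dots> + (\<Sum>u\<in>?W. \<Sum>v\<in>?W. c u v * (g u - g v)\<^sup>2) = 2 * walk_form ?W (star_mesh V k c) g"
    by (simp add: walk_form_def star_mesh_def distrib_right sum.distrib)
  finally have eq: "walk_form V c G = walk_form ?W (star_mesh V k c) g" by simp
  show ?thesis
  proof (cases "\<mu> \<ge> 0")
    case True
    then show ?thesis using mult_left_mono[OF ge True] le eq by linarith
  next
    \<comment> \<open>For negative \<mu> the comparison of norms points the wrong way, but the claim
      is trivial.\<close>
    case False
    have "\<mu> * sq_norm ?W g \<le> 0" using False by (simp add: mult_le_0_iff sum_nonneg)
    moreover have "walk_form V c G \<ge> 0" by (rule walk_form_nonneg[OF nonneg])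
    ultimately show ?thesis using eq by linarith
  qed
qed

text \<open>The weights are those of the reduced network but the shift energies remain on
  \<open>V\<close>: up to the factor 4, the left side is the sum over all cosets of the reduced
  interchange forms.\<close>

lemma interchange_form_star_mesh:
  assumes fin: "finite V" and k: "k \<in> V"
    and sym: "\<And>u v. u \<in> V \<Longrightarrow> v \<in> V \<Longrightarrow> c u v = c v u"
    and nonneg: "\<And>u v. u \<in> V \<Longrightarrow> v \<in> V \<Longrightarrow> c u v \<ge> 0"
    and octopus: "(\<Sum>u\<in>V - {k}. \<Sum>v\<in>V - {k}. c k u * c k v * shift_energy V f (tr u v))
      \<le> 2 * (\<Sum>u\<in>V - {k}. c k u) * (\<Sum>u\<in>V - {k}. c k u * shift_energy V f (tr k u))"
  shows "(\<Sum>u\<in>V - {k}. \<Sum>v\<in>V - {k}. star_mesh V k c u v * shift_energy V f (tr u v))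
    \<le> 4 * interchange_form V c f"
proof -
  let ?W = "V - {k}"
  define C where "C = (\<Sum>u\<in>?W. c k u)"
  define T where "T = (\<Sum>u\<in>?W. c k u * shift_energy V f (tr k u))"
  define X where "X = (\<Sum>u\<in>?W. \<Sum>v\<in>?W. c k u * c k v * shift_energy V f (tr u v))"
  have "C \<ge> 0" "T \<ge> 0" using nonneg k by (auto simp: C_def T_def shift_energy_nonneg intro!: sum_nonneg)
  \<comment> \<open>For \<open>C = 0\<close> the quotient is 0 and \<open>T \<ge> 0\<close>
    suffices.\<close>
  then have le: "X / C \<le> 2 * T"
    using octopus unfolding X_def[symmetric] T_def[symmetric] C_def[symmetric]
    by (cases "C = 0") (simp_all add: field_simps)
  have "(\<Sum>u\<in>?W. \<Sum>v\<in>?W. star_mesh V k c u v * shift_energy V f (tr u v)) =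
      (\<Sum>u\<in>?W. \<Sum>v\<in>?W. c u v * shift_energy V f (tr u v)) + X / C"
    by (simp add: star_mesh_def C_def[symmetric] X_def distrib_right sum.distrib sum_divide_distrib)
  moreover have "4 * interchange_form V c f = 2 * T + (\<Sum>u\<in>?W. \<Sum>v\<in>?W. c u v * shift_energy V f (tr u v))"
    unfolding interchange_form_def T_def
    by (simp, subst sum_split_vertex[OF fin k]) (auto simp: sym[OF _ k] transpose_commute[of _ k])
  ultimately show ?thesis using le by linarith
qed

lemma card_perms_ge_2:
  assumes "finite V" "card V \<ge> 2"
  shows "card (perms V) \<ge> 2"
proof -
  have "card (perms V) = fact (card V)" using assms(1) by (intro card_permutations) auto
  moreover have "fact 2 \<le> (fact (card V) :: nat)" using assms(2) by (rule fact_mono)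
  ultimately show ?thesis by simp
qed

text \<open>It suffices to show \<mu> \<le> \<open>l\<close> for the least interchange value
  \<open>l\<close>. An eigenfunction \<open>h\<close> is taken, not just a test function, because
  \<open>marginal_eigen\<close> needs the pointwise equation.\<close>

lemma aldous_star_mesh:
  assumes fin: "finite V" and k: "k \<in> V" and card: "card V \<ge> 2"
    and sym: "\<And>u v. u \<in> V \<Longrightarrow> v \<in> V \<Longrightarrow> c u v = c v u"
    and nonneg: "\<And>u v. u \<in> V \<Longrightarrow> v \<in> V \<Longrightarrow> c u v \<ge> 0"
    and octopus: "\<And>f. (\<Sum>u\<in>V - {k}. \<Sum>v\<in>V - {k}. c k u * c k v * shift_energy V f (tr u v))
      \<le> 2 * (\<Sum>u\<in>V - {k}. c k u) * (\<Sum>u\<in>V - {k}. c k u * shift_energy V f (tr k u))"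
    and IH: "aldous (V - {k}) (star_mesh V k c)"
  shows "aldous V c"
  unfolding aldous_def
proof (intro allI impI)
  let ?W = "V - {k}"
  fix \<mu> :: real and f :: "('a \<Rightarrow> 'a) \<Rightarrow> real"
  assume "\<forall>g. mean_zero V g \<longrightarrow> \<mu> * sq_norm V g \<le> walk_form V c g" and f: "mean_zero (perms V) f"
  then have bound: "\<And>g. mean_zero V g \<Longrightarrow> \<mu> * sq_norm V g \<le> walk_form V c g" by blast
  have finp: "finite (perms V)" using fin by (rule finite_permutations)
  obtain l h where h: "mean_zero (perms V) h" "sq_norm (perms V) h = 1"
    and "\<And>\<sigma>. \<sigma> \<in> perms V \<Longrightarrow> apply_kernel (perms V) (interchange_kernel V c) h \<sigma> = l * h \<sigma>"
    and "\<And>g. mean_zero (perms V) g \<Longrightarrow>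
      l * sq_norm (perms V) g \<le> kernel_form (perms V) (interchange_kernel V c) g"
    by (rule rayleigh_minimizer[OF finp card_perms_ge_2[OF fin card], of "interchange_kernel V c"])
      (use fin in \<open>auto simp: interchange_kernel_rows intro: interchange_kernel_sym\<close>)
  then have eigen: "\<And>\<sigma>. \<sigma> permutes V \<Longrightarrow> interchange_op V c h \<sigma> = l * h \<sigma>"
    and min: "\<And>g. mean_zero (perms V) g \<Longrightarrow> l * sq_norm (perms V) g \<le> interchange_form V c g"
    by (simp_all add: apply_interchange_kernel[OF fin] interchange_kernel_form[OF fin]
        sum_interchange_op)
  have "\<mu> \<le> l"
  proof (cases "\<exists>y\<in>V. \<exists>x\<in>V. marginal V h y x \<noteq> 0")
    case True
    then obtain y x where yx: "y \<in> V" "x \<in> V" "marginal V h y x \<noteq> 0" by blast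
    let ?M = "marginal V h y"
    have "mean_zero V ?M" using sum_marginal[OF fin yx(1)] h(1) by simp
    from bound[OF this] have "\<mu> * sq_norm V ?M \<le> (\<Sum>x\<in>V. ?M x * walk_op V c ?M x)"
      by (simp add: sum_walk_op sym)
    also have "\<dots> = (\<Sum>x\<in>V. ?M x * (l * ?M x))"
      by (intro sum.cong refl) (simp add: marginal_eigen[OF fin _ sym eigen])
    also have "\<dots> = l * sq_norm V ?M" by (simp add: sum_distrib_left power2_eq_square mult_ac)
    finally show ?thesis using sq_norm_pos[OF fin yx(2), of ?M] yx(3) by simp
  next
    case False
    define F where "F y \<pi> = h (\<pi> \<circ> tr y k)" for y \<pi>
    have "\<mu> * sq_norm (perms ?W) (F y) \<le> interchange_form ?W (star_mesh V k c) (F y)" if "y \<in> V" for y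
    proof -
      have "mean_zero (perms ?W) (F y)"
        using False marginal_coset[OF fin k that, of h] that k by (simp add: F_def)
      then show ?thesis
        using IH star_mesh_gap[OF fin k sym nonneg bound] unfolding aldous_def by blast
    qed
    then have "(\<Sum>y\<in>V. \<mu> * sq_norm (perms ?W) (F y)) \<le> (\<Sum>y\<in>V. interchange_form ?W (star_mesh V k c) (F y))"
      by (rule sum_mono)
    also have "(\<Sum>y\<in>V. \<mu> * sq_norm (perms ?W) (F y)) = \<mu> * sq_norm (perms V) h"
      by (simp add: F_def sum_perms_cosets[OF fin k, of "\<lambda>\<sigma>. (h \<sigma>)\<^sup>2"] sum_distrib_left)
    also have "\<mu> * sq_norm (perms V) h = \<mu>" by (simp add: h(2))
    also have "(\<Sum>y\<in>V. interchange_form ?W (star_mesh V k c) (F y)) =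
        (\<Sum>u\<in>?W. \<Sum>v\<in>?W. star_mesh V k c u v * (\<Sum>y\<in>V. shift_energy ?W (F y) (tr u v))) / 4"
      unfolding interchange_form_def sum_divide_distrib[symmetric] sum_distrib_left
      by (subst sum_swap3) (rule refl)
    \<comment> \<open>The reduced weights do not depend on \<open>y\<close>, so the energies of the
      cosets can be added before the octopus inequality is applied on \<open>V\<close>.\<close>
    also have "(\<Sum>y\<in>V. shift_energy ?W (F y) \<pi>) = shift_energy V h \<pi>" for \<pi>
      by (simp add: shift_energy_def F_def comp_assoc sum_perms_cosets[OF fin k, of "\<lambda>\<sigma>. (h \<sigma> - h (\<pi> \<circ> \<sigma>))\<^sup>2"])
    then have "(\<Sum>u\<in>?W. \<Sum>v\<in>?W. star_mesh V k c u v * (\<Sum>y\<in>V. shift_energy ?W (F y) (tr u v))) / 4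
        = (\<Sum>u\<in>?W. \<Sum>v\<in>?W. star_mesh V k c u v * shift_energy V h (tr u v)) / 4" by simp
    also have "\<dots> \<le> interchange_form V c h"
      using interchange_form_star_mesh[OF fin k sym nonneg octopus, of h] by simp
    also have "\<dots> = (\<Sum>\<sigma>\<in>perms V. h \<sigma> * (l * h \<sigma>))"
      unfolding sum_interchange_op[symmetric] by (intro sum.cong refl) (simp add: eigen)
    also have "\<dots> = l * sq_norm (perms V) h" by (simp add: sum_distrib_left power2_eq_square mult_ac)
    finally show ?thesis by (simp add: h(2))
  qed
  then have "\<mu> * sq_norm (perms V) f \<le> l * sq_norm (perms V) f"
    by (intro mult_right_mono sum_nonneg) auto
  also have "\<dots> \<le> interchange_form V c f" by (rule min[OF f])
  finally show "\<mu> * sq_norm (perms V) f \<le> interchange_form V c f" .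
qed

section \<open>Reducible graphs\<close>

lemma perms_doubleton:
  assumes "u \<noteq> v"
  shows "perms {u, v} = {id, tr u v}"
proof
  show "perms {u, v} \<subseteq> {id, tr u v}"
  proof
    fix \<sigma> assume "\<sigma> \<in> perms {u, v}"
    then have \<sigma>: "\<sigma> permutes {u, v}" by simp
    then have "\<sigma> u \<in> {u, v}" "\<sigma> v \<in> {u, v}"
      using permutes_in_image[OF \<sigma>, of u] permutes_in_image[OF \<sigma>, of v] by simp_all
    moreover have "\<sigma> u \<noteq> \<sigma> v" using \<sigma> assms by (metis permutes_inverses(2))
    ultimately show "\<sigma> \<in> {id, tr u v}"
      using permutes_not_in[OF \<sigma>] by (auto simp: fun_eq_iff transpose_def) metis+
  qed
qed (auto simp: permutes_id intro: tr_permutes)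

text \<open>With two vertices the processes coincide: \<open>f\<close> takes values \<open>a\<close>
  and \<open>- a\<close> on the two permutations, and the walk bound is tested on the function with
  these values on the two vertices.\<close>

lemma aldous_doubleton:
  assumes uv: "u \<noteq> v" and sym: "c u v = c v u"
  shows "aldous {u, v} c"
  unfolding aldous_def
proof (intro allI impI)
  fix \<mu> :: real and f :: "('a \<Rightarrow> 'a) \<Rightarrow> real"
  assume bound: "\<forall>g. mean_zero {u, v} g \<longrightarrow> \<mu> * sq_norm {u, v} g \<le> walk_form {u, v} c g"
    and f: "mean_zero (perms {u, v}) f"
  define a where "a = f id"
  have ne: "id \<noteq> tr u v" using uv by (metis transpose_eq_id_iff)
  have fa: "f (tr u v) = - a" using f ne by (simp add: perms_doubleton[OF uv] a_def)
  have "tr v u = tr u v" by (rule transpose_commute)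
  then have "shift_energy {u, v} f (tr u v) = 8 * a\<^sup>2" "shift_energy {u, v} f (tr v u) = 8 * a\<^sup>2"
    using ne by (simp_all add: shift_energy_def perms_doubleton[OF uv] fa a_def[symmetric] power2_eq_square)
  then have "interchange_form {u, v} c f = 4 * c u v * a\<^sup>2"
    using uv sym by (simp add: interchange_form_def)
  moreover have "sq_norm (perms {u, v}) f = 2 * a\<^sup>2"
    using ne by (simp add: perms_doubleton[OF uv] fa a_def[symmetric])
  moreover have "\<mu> * (2 * a\<^sup>2) \<le> 4 * c u v * a\<^sup>2"
    using bound[rule_format, of "\<lambda>x. if x = u then a else - a"] uv sym
    by (simp add: walk_form_def power2_eq_square)
  ultimately show "\<mu> * sq_norm (perms {u, v}) f \<le> interchange_form {u, v} c f" by simp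
qed

lemma octopus_support:
  assumes fin: "finite W" and L: "L \<subseteq> W" and supp: "\<And>u. u \<in> W - L \<Longrightarrow> a u = 0"
    and oct: "(\<Sum>u\<in>L. \<Sum>v\<in>L. a u * a v * shift_energy V f (tr u v))
      \<le> 2 * (\<Sum>u\<in>L. a u) * (\<Sum>u\<in>L. a u * shift_energy V f (tr k u))"
  shows "(\<Sum>u\<in>W. \<Sum>v\<in>W. a u * a v * shift_energy V f (tr u v))
      \<le> 2 * (\<Sum>u\<in>W. a u) * (\<Sum>u\<in>W. a u * shift_energy V f (tr k u))"
proof -
  have restrict: "(\<Sum>u\<in>W. a u * h u) = (\<Sum>u\<in>L. a u * h u)" for h :: "'a \<Rightarrow> real"
    by (rule sum.mono_neutral_right[OF fin L]) (simp add: supp)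
  have "(\<Sum>u\<in>W. \<Sum>v\<in>W. a u * a v * shift_energy V f (tr u v)) =
      (\<Sum>u\<in>W. a u * (\<Sum>v\<in>W. a v * shift_energy V f (tr u v)))"
    by (simp add: sum_distrib_left mult.assoc)
  also have "\<dots> = (\<Sum>u\<in>L. \<Sum>v\<in>L. a u * a v * shift_energy V f (tr u v))"
    unfolding restrict by (simp add: sum_distrib_left mult.assoc)
  finally show ?thesis
    using oct restrict[of "\<lambda>_. 1"] by (simp add: restrict)
qed

lemma octopus_at_most_three:
  assumes V: "k \<in> V" "i \<in> V" "j \<in> V" "l \<in> V" and dist: "distinct [k, i, j, l]"
    and nonneg: "a i \<ge> 0" "a j \<ge> 0" "a l \<ge> 0"
  shows "(\<Sum>u\<in>{i, j, l}. \<Sum>v\<in>{i, j, l}. a u * a v * shift_energy V f (tr u v))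
      \<le> 2 * (\<Sum>u\<in>{i, j, l}. a u) * (\<Sum>u\<in>{i, j, l}. a u * shift_energy V f (tr k u))"
  using octopus_three_legs[OF V dist nonneg, of f] dist
  by (simp add: transpose_commute[of j i] transpose_commute[of l] algebra_simps)

lemma octopus_at_most_two:
  assumes V: "k \<in> V" "i \<in> V" "j \<in> V" and dist: "distinct [k, i, j]"
    and nonneg: "a i \<ge> 0" "a j \<ge> 0"
  shows "(\<Sum>u\<in>{i, j}. \<Sum>v\<in>{i, j}. a u * a v * shift_energy V f (tr u v))
      \<le> 2 * (\<Sum>u\<in>{i, j}. a u) * (\<Sum>u\<in>{i, j}. a u * shift_energy V f (tr k u))"
  using octopus_two_legs[OF V dist nonneg, of f] dist
  by (simp add: transpose_commute[of j i] algebra_simps)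

section \<open>Weighted multigraphs and the reduction steps\<close>

text \<open>Weights belong to pairs of vertices, so parallel edges share one weight. The support
  condition omits the diagonal because \<open>star_mesh\<close> creates nonzero values
  \<open>c u u\<close>.\<close>

definition weights_on :: "'a multigraph \<Rightarrow> ('a \<Rightarrow> 'a \<Rightarrow> real) \<Rightarrow> bool" where
  "weights_on H c \<longleftrightarrow> (\<forall>u\<in>fst H. \<forall>v\<in>fst H. c u v = c v u \<and> c u v \<ge> 0 \<and>
    (u \<noteq> v \<longrightarrow> {u, v} \<notin># snd H \<longrightarrow> c u v = 0))"

definition wf_multigraph :: "'a multigraph \<Rightarrow> bool" where
  "wf_multigraph H \<longleftrightarrow> finite (fst H) \<and> (\<forall>e\<in>#snd H. e \<subseteq> fst H)"

text \<open>All weights at once: a reduction step prescribes only the new edges, while their weights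
  are dictated by \<open>star_mesh\<close>.\<close>

definition aldous_graph :: "'a multigraph \<Rightarrow> bool" where
  "aldous_graph H \<longleftrightarrow> (\<forall>c. weights_on H c \<longrightarrow> aldous (fst H) c)"

lemma in_minus_incident:
  assumes "incident M k = N" "e \<in># M - N"
  shows "k \<notin> e"
proof
  assume "k \<in> e"
  then have "count N e = count M e" using assms(1)[symmetric] by (simp add: incident_def)
  then show False using assms(2) by (simp add: in_diff_count)
qed

lemma incident_edges:
  assumes "incident M k = N"
  shows "e \<in># M \<and> k \<in> e \<longleftrightarrow> e \<in># N"
  using assms[symmetric] by (simp add: incident_def)

lemma wf_multigraph_eliminate:
  assumes "wf_multigraph (V, M)" "incident M k = N" "\<And>e. e \<in># D \<Longrightarrow> e \<subseteq> V - {k}"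
  shows "wf_multigraph (V - {k}, M - N + D)"
proof -
  have "e \<subseteq> V - {k}" if "e \<in># M - N" for e
    using in_minus_incident[OF assms(2) that] in_diffD[OF that] assms(1)
    by (auto simp: wf_multigraph_def)
  then show ?thesis using assms(1,3) by (auto simp: wf_multigraph_def)
qed

lemma wf_multigraph_step:
  assumes "reduction_step X Y" "wf_multigraph X"
  shows "wf_multigraph Y"
  using assms
proof (induction rule: reduction_step.induct)
  case (degree_one k V M e)
  then show ?case using wf_multigraph_eliminate[of V M k "{#e#}" "{#}"] by simp
next
  case (series k V i j M)
  have "{i, k} \<in># M" "{j, k} \<in># M"
    using incident_edges[OF series.hyps(3)] by (metis insert_iff set_mset_add_mset_insert)+
  then have "{i, k} \<subseteq> V" "{j, k} \<subseteq> V" using series.prems by (auto simp: wf_multigraph_def)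
  then show ?case
    using series.hyps(2) by (intro wf_multigraph_eliminate[OF series.prems series.hyps(3)]) auto
next
  case (parallel M e V)
  then show ?case by (auto simp: wf_multigraph_def dest: in_diffD)
next
  case (Y_Delta k V i j l M)
  have "{i, k} \<in># M" "{j, k} \<in># M" "{l, k} \<in># M"
    using incident_edges[OF Y_Delta.hyps(3)] by (metis insert_iff set_mset_add_mset_insert)+
  then have "{i, k} \<subseteq> V" "{j, k} \<subseteq> V" "{l, k} \<subseteq> V" using Y_Delta.prems by (auto simp: wf_multigraph_def)
  then show ?case
    using Y_Delta.hyps(2) by (intro wf_multigraph_eliminate[OF Y_Delta.prems Y_Delta.hyps(3)]) auto
qed

text \<open>A new weight can be nonzero only on an old edge or between two neighbours of
  \<open>k\<close>; \<open>edges\<close> and \<open>nbrs\<close> put these pairs into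
  \<open>M'\<close>.\<close>

lemma weights_on_star_mesh:
  assumes c: "weights_on (V, M) c" and k: "k \<in> V"
    and edges: "\<And>u v. {u, v} \<in># M \<Longrightarrow> u \<noteq> k \<Longrightarrow> v \<noteq> k \<Longrightarrow> u \<noteq> v \<Longrightarrow> {u, v} \<in># M'"
    and nbrs: "\<And>u v. {k, u} \<in># M \<Longrightarrow> {k, v} \<in># M \<Longrightarrow> u \<noteq> k \<Longrightarrow> v \<noteq> k \<Longrightarrow> u \<noteq> v \<Longrightarrow> {u, v} \<in># M'"
  shows "weights_on (V - {k}, M') (star_mesh V k c)"
proof -
  have nonneg: "c u v \<ge> 0" if "u \<in> V" "v \<in> V" for u v using c that by (auto simp: weights_on_def)
  have "star_mesh V k c u v = 0" if "u \<in> V - {k}" "v \<in> V - {k}" "u \<noteq> v" "{u, v} \<notin># M'" for u v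
  proof -
    have "{u, v} \<notin># M" "{k, u} \<notin># M \<or> {k, v} \<notin># M" using that edges nbrs by blast+
    then show ?thesis using that c k by (auto simp: weights_on_def star_mesh_def)
  qed
  moreover have "star_mesh V k c u v \<ge> 0" if "u \<in> V - {k}" "v \<in> V - {k}" for u v
    using that nonneg k by (auto simp: star_mesh_def intro!: add_nonneg_nonneg divide_nonneg_nonneg sum_nonneg)
  ultimately show ?thesis using c unfolding weights_on_def by (auto simp: star_mesh_def)
qed

text \<open>The common core of the degree-one, series and Y-Delta cases. \<open>L\<close> contains
  the neighbours of \<open>k\<close>, and the octopus inequality is required for these legs
  only.\<close>

lemma aldous_graph_eliminate:
  assumes wf: "wf_multigraph (V, M)" and k: "k \<in> V" and card: "card (V - {k}) \<ge> 1"
    and edges: "\<And>u v. {u, v} \<in># M \<Longrightarrow> u \<noteq> k \<Longrightarrow> v \<noteq> k \<Longrightarrow> u \<noteq> v \<Longrightarrow> {u, v} \<in># M'"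
    and nbrs: "\<And>u v. {k, u} \<in># M \<Longrightarrow> {k, v} \<in># M \<Longrightarrow> u \<noteq> k \<Longrightarrow> v \<noteq> k \<Longrightarrow> u \<noteq> v \<Longrightarrow> {u, v} \<in># M'"
    and L: "L \<subseteq> V - {k}" "\<And>u. u \<in> V - {k} - L \<Longrightarrow> {k, u} \<notin># M"
    and oct: "\<And>a f. (\<And>u. u \<in> L \<Longrightarrow> a u \<ge> 0) \<Longrightarrow>
      (\<Sum>u\<in>L. \<Sum>v\<in>L. a u * a v * shift_energy V f (tr u v))
      \<le> 2 * (\<Sum>u\<in>L. a u) * (\<Sum>u\<in>L. a u * shift_energy V f (tr k u))"
    and IH: "aldous_graph (V - {k}, M')"
  shows "aldous_graph (V, M)"
  unfolding aldous_graph_def fst_conv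
proof (intro allI impI)
  fix c assume c: "weights_on (V, M) c"
  have fin: "finite V" using wf by (simp add: wf_multigraph_def)
  have nonneg: "c u v \<ge> 0" if "u \<in> V" "v \<in> V" for u v using c that by (auto simp: weights_on_def)
  show "aldous V c"
  proof (rule aldous_star_mesh[OF fin k])
    show "card V \<ge> 2" using card fin k by simp
    show "c u v = c v u" "c u v \<ge> 0" if "u \<in> V" "v \<in> V" for u v
      using c that by (auto simp: weights_on_def)
    show "aldous (V - {k}) (star_mesh V k c)"
      using IH weights_on_star_mesh[OF c k edges nbrs] by (simp add: aldous_graph_def)
    show "(\<Sum>u\<in>V - {k}. \<Sum>v\<in>V - {k}. c k u * c k v * shift_energy V f (tr u v))
      \<le> 2 * (\<Sum>u\<in>V - {k}. c k u) * (\<Sum>u\<in>V - {k}. c k u * shift_energy V f (tr k u))" for f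
    proof (rule octopus_support[OF _ L(1)])
      show "finite (V - {k})" using fin by simp
      show "c k u = 0" if "u \<in> V - {k} - L" for u using c k L(2)[OF that] that by (auto simp: weights_on_def)
      show "(\<Sum>u\<in>L. \<Sum>v\<in>L. c k u * c k v * shift_energy V f (tr u v))
        \<le> 2 * (\<Sum>u\<in>L. c k u) * (\<Sum>u\<in>L. c k u * shift_energy V f (tr k u))"
        by (rule oct) (use nonneg k L in blast)
    qed
  qed
qed

lemma aldous_graph_step:
  assumes "reduction_step X Y" "wf_multigraph X" "card (fst Y) \<ge> 1" "aldous_graph Y"
  shows "aldous_graph X"
  using assms
proof (induction rule: reduction_step.induct)
  case (degree_one k V M e)
  have e: "e' = e" if "e' \<in># M" "k \<in> e'" for e'
    using incident_edges[OF degree_one.hyps(2), of e'] that by simp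
  show ?case
  proof (rule aldous_graph_eliminate[where M' = "M - {#e#}" and L = "{u \<in> V - {k}. {k, u} = e}"])
    have "e \<in># incident M k" using degree_one.hyps(2) by simp
    then have ke: "k \<in> e" by (simp add: incident_def)
    show "{u, v} \<in># M - {#e#}" if "{u, v} \<in># M" "u \<noteq> k" "v \<noteq> k" for u v
    proof -
      have "{u, v} \<noteq> e" using that ke by auto
      then show ?thesis using that(1) by (simp add: in_diff_count)
    qed
    show "{u, v} \<in># M - {#e#}" if "{k, u} \<in># M" "{k, v} \<in># M" "u \<noteq> k" "v \<noteq> k" "u \<noteq> v" for u v
      using e[OF that(1)] e[OF that(2)] that(3-5) by (auto simp: doubleton_eq_iff)
    show "{k, u} \<notin># M" if "u \<in> V - {k} - {u \<in> V - {k}. {k, u} = e}" for u using e that by blast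
    fix a :: "'a \<Rightarrow> real" and f
    assume a: "\<And>u. u \<in> {u \<in> V - {k}. {k, u} = e} \<Longrightarrow> a u \<ge> 0"
    \<comment> \<open>\<open>wf_multigraph\<close> does not say that \<open>e\<close> is a pair, so
      \<open>k\<close> may turn out to have no neighbour at all; with a single leg the left side is
      0.\<close>
    consider "{u \<in> V - {k}. {k, u} = e} = {}" | u where "{u \<in> V - {k}. {k, u} = e} = {u}"
    proof (cases "\<exists>u\<in>V - {k}. {k, u} = e")
      case True
      then obtain u where u: "u \<in> V - {k}" "{k, u} = e" by blast
      then have "{u \<in> V - {k}. {k, u} = e} = {u}" by (auto simp: doubleton_eq_iff)
      then show thesis using that by blast
    qed (use that in blast)
    then show "(\<Sum>u\<in>{u \<in> V - {k}. {k, u} = e}. \<Sum>v\<in>{u \<in> V - {k}. {k, u} = e}. a u * a v * shift_energy V f (tr u v))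
      \<le> 2 * (\<Sum>u\<in>{u \<in> V - {k}. {k, u} = e}. a u) * (\<Sum>u\<in>{u \<in> V - {k}. {k, u} = e}. a u * shift_energy V f (tr k u))"
    proof cases
      case 1
      show ?thesis unfolding 1 by simp
    next
      case (2 u)
      then have "a u \<ge> 0" using a by blast
      then show ?thesis unfolding 2 by (simp add: shift_energy_nonneg)
    qed
  qed (use degree_one in auto)
next
  case (series k V i j M)
  let ?N = "{#{i, k}, {j, k}#}"
  have "{i, k} \<in># M" "{j, k} \<in># M"
    using incident_edges[OF series.hyps(3)] by (metis insert_iff set_mset_add_mset_insert)+
  then have "{i, k} \<subseteq> V" "{j, k} \<subseteq> V" using series.prems(1) by (auto simp: wf_multigraph_def)
  then have V: "i \<in> V" "j \<in> V" by simp_all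
  have nbr: "u = i \<or> u = j" if "{k, u} \<in># M" for u
  proof -
    have "{k, u} \<in># ?N" using incident_edges[OF series.hyps(3), of "{k, u}"] that by simp
    then show ?thesis by (auto simp: doubleton_eq_iff)
  qed
  show ?case
  proof (rule aldous_graph_eliminate[where M' = "M - ?N + {#{i, j}#}" and L = "{i, j}"])
    show "{u, v} \<in># M - ?N + {#{i, j}#}" if "{u, v} \<in># M" "u \<noteq> k" "v \<noteq> k" for u v
      using that by (auto simp: in_diff_count doubleton_eq_iff)
    show "{u, v} \<in># M - ?N + {#{i, j}#}" if "{k, u} \<in># M" "{k, v} \<in># M" "u \<noteq> v" for u v
      using nbr[OF that(1)] nbr[OF that(2)] that(3) by (auto simp: insert_commute)
    show "{i, j} \<subseteq> V - {k}" using V series.hyps by auto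
    show "{k, u} \<notin># M" if "u \<in> V - {k} - {i, j}" for u using that nbr by blast
    show "(\<Sum>u\<in>{i, j}. \<Sum>v\<in>{i, j}. a u * a v * shift_energy V f (tr u v))
      \<le> 2 * (\<Sum>u\<in>{i, j}. a u) * (\<Sum>u\<in>{i, j}. a u * shift_energy V f (tr k u))"
      if "\<And>u. u \<in> {i, j} \<Longrightarrow> a u \<ge> 0" for a :: "'a \<Rightarrow> real" and f
      by (rule octopus_at_most_two[OF series.hyps(1) V series.hyps(2)]) (use that in simp_all)
    show "wf_multigraph (V, M)" "k \<in> V" by (fact series)+
    show "card (V - {k}) \<ge> 1" using series.prems(2) by simp
    show "aldous_graph (V - {k}, M - ?N + {#{i, j}#})" by (fact series.prems(3))
  qed
next
  case (parallel M e V)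
  \<comment> \<open>Another copy of \<open>e\<close> remains, and \<open>weights_on\<close> sees
    only the support of the multiset.\<close>
  have "e' \<in># M - {#e#}" if "e' \<in># M" for e'
    using that parallel.hyps by (cases "e' = e") (auto simp: in_diff_count)
  then have "set_mset (M - {#e#}) = set_mset M" by (auto dest: in_diffD)
  then show ?case using parallel.prems by (simp add: aldous_graph_def weights_on_def)
next
  case (Y_Delta k V i j l M)
  let ?N = "{#{i, k}, {j, k}, {l, k}#}"
  let ?D = "{#{i, j}, {j, l}, {i, l}#}"
  have "{i, k} \<in># M" "{j, k} \<in># M" "{l, k} \<in># M"
    using incident_edges[OF Y_Delta.hyps(3)] by (metis insert_iff set_mset_add_mset_insert)+
  then have "{i, k} \<subseteq> V" "{j, k} \<subseteq> V" "{l, k} \<subseteq> V" using Y_Delta.prems(1) by (auto simp: wf_multigraph_def)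
  then have V: "i \<in> V" "j \<in> V" "l \<in> V" by simp_all
  have nbr: "u = i \<or> u = j \<or> u = l" if "{k, u} \<in># M" for u
  proof -
    have "{k, u} \<in># ?N" using incident_edges[OF Y_Delta.hyps(3), of "{k, u}"] that by simp
    then show ?thesis by (auto simp: doubleton_eq_iff)
  qed
  show ?case
  proof (rule aldous_graph_eliminate[where M' = "M - ?N + ?D" and L = "{i, j, l}"])
    show "{u, v} \<in># M - ?N + ?D" if "{u, v} \<in># M" "u \<noteq> k" "v \<noteq> k" for u v
      using that by (auto simp: in_diff_count doubleton_eq_iff)
    show "{u, v} \<in># M - ?N + ?D" if "{k, u} \<in># M" "{k, v} \<in># M" "u \<noteq> v" for u v
      using nbr[OF that(1)] nbr[OF that(2)] that(3) by (auto simp: insert_commute)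
    show "{i, j, l} \<subseteq> V - {k}" using V Y_Delta.hyps by auto
    show "{k, u} \<notin># M" if "u \<in> V - {k} - {i, j, l}" for u using that nbr by blast
    show "(\<Sum>u\<in>{i, j, l}. \<Sum>v\<in>{i, j, l}. a u * a v * shift_energy V f (tr u v))
      \<le> 2 * (\<Sum>u\<in>{i, j, l}. a u) * (\<Sum>u\<in>{i, j, l}. a u * shift_energy V f (tr k u))"
      if "\<And>u. u \<in> {i, j, l} \<Longrightarrow> a u \<ge> 0" for a :: "'a \<Rightarrow> real" and f
      by (rule octopus_at_most_three[OF Y_Delta.hyps(1) V Y_Delta.hyps(2)]) (use that in simp_all)
    show "wf_multigraph (V, M)" "k \<in> V" by (fact Y_Delta)+
    show "card (V - {k}) \<ge> 1" using Y_Delta.prems(2) by simp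
    show "aldous_graph (V - {k}, M - ?N + ?D)" by (fact Y_Delta.prems(3))
  qed
qed

text \<open>Induction backwards from the single edge. The cardinality is carried along because an
  elimination must leave a vertex behind; it follows since vertex sets shrink along
  reductions.\<close>

lemma aldous_graph_reducible:
  assumes "reduction_step\<^sup>*\<^sup>* X H" "single_edge H" "wf_multigraph X"
  shows "aldous_graph X \<and> card (fst X) \<ge> 1"
  using assms(1,3)
proof (induction rule: converse_rtranclp_induct)
  case base
  then show ?case
    using assms(2) by (auto simp: single_edge_def aldous_graph_def weights_on_def intro!: aldous_doubleton)
next
  case (step X Y)
  then have IH: "aldous_graph Y" "card (fst Y) \<ge> 1" using wf_multigraph_step by blast+
  have "fst Y \<subseteq> fst X" using step.hyps(1) by cases auto
  moreover have "finite (fst X)" using step.prems by (simp add: wf_multigraph_def)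
  ultimately have "card (fst X) \<ge> 1" using IH(2) by (meson card_mono order_trans)
  then show ?case using aldous_graph_step[OF step.hyps(1) step.prems] IH by blast
qed

section \<open>The spectral gaps\<close>

lemma apply_RW_laplacian:
  assumes x: "x \<in> {1..n}" and sym: "\<And>u v. u \<in> {1..n} \<Longrightarrow> v \<in> {1..n} \<Longrightarrow> \<alpha> u v = \<alpha> v u"
  shows "apply_kernel {1..n} (RW_laplacian n \<alpha>) g x = walk_op {1..n} \<alpha> g x"
proof -
  have "apply_kernel {1..n} (RW_laplacian n \<alpha>) g x =
      RW_laplacian n \<alpha> x x * g x + (\<Sum>v\<in>{1..n} - {x}. RW_laplacian n \<alpha> x v * g v)"
    using x by (intro sum.remove) auto
  also have "(\<Sum>v\<in>{1..n} - {x}. RW_laplacian n \<alpha> x v * g v) = (\<Sum>v\<in>{1..n} - {x}. - \<alpha> x v * g v)"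
    by (intro sum.cong) (auto simp: RW_laplacian_def)
  also have "RW_laplacian n \<alpha> x x * g x = (\<Sum>v\<in>{1..n} - {x}. \<alpha> x v * g x)"
    using x by (auto simp: RW_laplacian_def sum_distrib_right sym intro!: sum.cong)
  also have "\<dots> + (\<Sum>v\<in>{1..n} - {x}. - \<alpha> x v * g v) = (\<Sum>v\<in>{1..n} - {x}. \<alpha> x v * (g x - g v))"
    by (simp add: right_diff_distrib sum_subtractf sum_negf)
  also have "\<dots> = walk_op {1..n} \<alpha> g x"
    unfolding walk_op_def using x by (subst (2) sum.remove[of _ x]) auto
  finally show ?thesis .
qed

lemma RW_laplacian_sym:
  assumes "\<And>u v. u \<in> {1..n} \<Longrightarrow> v \<in> {1..n} \<Longrightarrow> \<alpha> u v = \<alpha> v u" "i \<in> {1..n}" "j \<in> {1..n}"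
  shows "RW_laplacian n \<alpha> i j = RW_laplacian n \<alpha> j i"
  using assms by (auto simp: RW_laplacian_def)

lemma half_sum_pairs:
  fixes F :: "nat \<Rightarrow> nat \<Rightarrow> real"
  assumes sym: "\<And>u v. u \<in> {1..n} \<Longrightarrow> v \<in> {1..n} \<Longrightarrow> F u v = F v u" and diag: "\<And>u. F u u = 0"
  shows "(\<Sum>u\<in>{1..n}. \<Sum>v\<in>{1..n}. F u v) / 2 = (\<Sum>(u, v)\<in>{(u, v). 1 \<le> u \<and> u < v \<and> v \<le> n}. F u v)"
proof -
  define U where "U u v = (if u < v then F u v else 0)" for u v
  have "(\<Sum>u\<in>{1..n}. \<Sum>v\<in>{1..n}. F u v) = (\<Sum>u\<in>{1..n}. \<Sum>v\<in>{1..n}. U u v + U v u)"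
    using sym diag by (intro sum.cong refl) (auto simp: U_def not_less order_less_le)
  also have "\<dots> = 2 * (\<Sum>u\<in>{1..n}. \<Sum>v\<in>{1..n}. U u v)"
    unfolding sum.distrib by (subst (2) sum.swap) simp
  also have "(\<Sum>u\<in>{1..n}. \<Sum>v\<in>{1..n}. U u v) = (\<Sum>(u, v)\<in>{1..n} \<times> {1..n}. U u v)"
    by (rule sum.cartesian_product)
  also have "\<dots> = (\<Sum>(u, v)\<in>{(u, v). 1 \<le> u \<and> u < v \<and> v \<le> n}. F u v)"
    by (rule sum.mono_neutral_cong_right) (auto simp: U_def split: if_splits)
  finally show ?thesis by simp
qed

lemma interchange_laplacian_eq_kernel:
  assumes sym: "\<And>u v. u \<in> {1..n} \<Longrightarrow> v \<in> {1..n} \<Longrightarrow> \<alpha> u v = \<alpha> v u" and \<sigma>: "\<sigma> permutes {1..n}"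
  shows "interchange_laplacian n \<alpha> \<sigma> \<sigma>' = interchange_kernel {1..n} \<alpha> \<sigma> \<sigma>'"
proof -
  let ?P = "{(u, v). 1 \<le> u \<and> u < v \<and> v \<le> n}"
  have fin: "finite ?P" by (rule finite_subset[of _ "{1..n} \<times> {1..n}"]) auto
  \<comment> \<open>For \<open>u < v\<close> the second indicator in \<open>F\<close> thus vanishes
    on the diagonal, leaving the full sum of weights.\<close>
  have tr_fix: "\<sigma> = tr u v \<circ> \<sigma> \<longleftrightarrow> u = v" for u v
  proof
    assume "\<sigma> = tr u v \<circ> \<sigma>"
    then have "tr u v = id" using permutes_surj[OF \<sigma>] by (metis comp_apply ext id_apply surjD)
    then show "u = v" by (simp add: transpose_eq_id_iff)
  qed simp
  define F where "F u v = \<alpha> u v * (of_bool (\<sigma>' = \<sigma>) - of_bool (\<sigma>' = tr u v \<circ> \<sigma>))" for u v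
  have "interchange_kernel {1..n} \<alpha> \<sigma> \<sigma>' = (\<Sum>(u, v)\<in>?P. F u v)"
    unfolding interchange_kernel_def F_def[symmetric]
    by (rule half_sum_pairs) (auto simp: F_def sym transpose_commute)
  also have "\<dots> = interchange_laplacian n \<alpha> \<sigma> \<sigma>'"
  proof (cases "\<sigma>' = \<sigma>")
    case True
    then show ?thesis
      by (auto simp: interchange_laplacian_def F_def tr_fix intro!: sum.cong)
  next
    case False
    have "{(i, j). 1 \<le> i \<and> i < j \<and> j \<le> n \<and> \<sigma>' = tr i j \<circ> \<sigma>} = {p \<in> ?P. \<sigma>' = tr (fst p) (snd p) \<circ> \<sigma>}"
      by auto
    then have "interchange_laplacian n \<alpha> \<sigma> \<sigma>' = - (\<Sum>p\<in>{p \<in> ?P. \<sigma>' = tr (fst p) (snd p) \<circ> \<sigma>}. \<alpha> (fst p) (snd p))"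
      using False by (simp add: interchange_laplacian_def case_prod_beta)
    also have "\<dots> = (\<Sum>(u, v)\<in>?P. F u v)"
      unfolding sum.inter_filter[OF fin] sum_negf[symmetric] using False
      by (intro sum.cong refl) (auto simp: F_def)
    finally show ?thesis by simp
  qed
  finally show ?thesis by simp
qed

lemma indexed_mat_cong:
  assumes "\<And>i j. i \<in> I \<Longrightarrow> j \<in> I \<Longrightarrow> K i j = K' i j"
  shows "indexed_mat I K = indexed_mat I K'"
  unfolding indexed_mat_def
proof (intro cong_mat refl)
  fix a b assume "a < card I" "b < card I"
  then have "from_nat_into I a \<in> I" "from_nat_into I b \<in> I"
    by (metis card.empty from_nat_into not_less_zero)+
  then show "(case (a, b) of (a, b) \<Rightarrow> K (from_nat_into I a) (from_nat_into I b)) =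
      (case (a, b) of (a, b) \<Rightarrow> K' (from_nat_into I a) (from_nat_into I b))"
    using assms by simp
qed

lemma walk_form_zero_imp_const:
  assumes fin: "finite V" and nonneg: "\<And>u v. u \<in> V \<Longrightarrow> v \<in> V \<Longrightarrow> c u v \<ge> 0"
    and zero: "walk_form V c g \<le> 0"
    and conn: "connected_graph V E" and E: "\<And>u v. {u, v} \<in> E \<Longrightarrow> u \<in> V \<and> v \<in> V \<and> c u v \<noteq> 0"
    and uv: "u \<in> V" "v \<in> V"
  shows "g u = g v"
proof -
  have edge: "g x = g y" if "{x, y} \<in> E" for x y
  proof -
    note xy = E[OF that]
    have "c x y * (g x - g y)\<^sup>2 \<le> (\<Sum>v\<in>V. c x v * (g x - g v)\<^sup>2)"
      using xy nonneg fin by (intro member_le_sum) auto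
    also have "\<dots> \<le> (\<Sum>u\<in>V. \<Sum>v\<in>V. c u v * (g u - g v)\<^sup>2)"
      using xy nonneg fin by (intro member_le_sum[of x V "\<lambda>u. \<Sum>v\<in>V. c u v * (g u - g v)\<^sup>2"] sum_nonneg) auto
    also have "\<dots> \<le> 0" using zero by (simp add: walk_form_def)
    finally have "c x y * (g x - g y)\<^sup>2 \<le> 0" .
    moreover have "c x y > 0" using xy nonneg[of x y] by auto
    ultimately show ?thesis by (simp add: mult_le_0_iff)
  qed
  have "(u, v) \<in> {(x, y). {x, y} \<in> E}\<^sup>*" using conn uv by (simp add: connected_graph_def)
  then show ?thesis by (induction rule: rtrancl_induct) (auto dest: edge)
qed

theorem mainTheorem7:
  fixes n :: nat and E :: "nat set set" and \<alpha> :: "nat \<Rightarrow> nat \<Rightarrow> real"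
  assumes "n \<ge> 2"
    and "simple_graph {1..n} E"
    and "connected_graph {1..n} E"
    and "reducible_to_edge {1..n} E"
    and "\<And>i j. i \<in> {1..n} \<Longrightarrow> j \<in> {1..n} \<Longrightarrow> \<alpha> i j = \<alpha> j i"
    and "\<And>i j. i \<in> {1..n} \<Longrightarrow> j \<in> {1..n} \<Longrightarrow> \<alpha> i j \<ge> 0"
    and "\<And>i j. i \<in> {1..n} \<Longrightarrow> j \<in> {1..n} \<Longrightarrow> {i, j} \<notin> E \<Longrightarrow> \<alpha> i j = 0"
    and "connected_graph {1..n} (E - {{i, j} | i j. {i, j} \<in> E \<and> \<alpha> i j = 0})"
  shows "interchange_gap n \<alpha> = RW_gap n \<alpha>"
proof -
  let ?V = "{1..n}"
  note sym = assms(5) and nonneg = assms(6)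
  have fin: "finite ?V" and card: "card ?V \<ge> 2" using assms(1) by simp_all
  have one: "1 \<in> ?V" using assms(1) by simp
  have E: "E \<subseteq> Pow ?V" using assms(2) by (auto simp: simple_graph_def)
  then have finE: "finite E" by (rule finite_subset) simp
  obtain H where H: "reduction_step\<^sup>*\<^sup>* (?V, mset_set E) H" "single_edge H"
    using assms(4) by (auto simp: reducible_to_edge_def)
  have "wf_multigraph (?V, mset_set E)" using E finE by (auto simp: wf_multigraph_def)
  then have "aldous_graph (?V, mset_set E)" using aldous_graph_reducible[OF H] by blast
  moreover have "weights_on (?V, mset_set E) \<alpha>"
    unfolding weights_on_def fst_conv snd_conv
  proof (intro ballI conjI impI)
    fix u v assume uv: "u \<in> ?V" "v \<in> ?V"
    show "\<alpha> u v = \<alpha> v u" by (rule sym[OF uv])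
    show "\<alpha> u v \<ge> 0" by (rule nonneg[OF uv])
    assume "{u, v} \<notin># mset_set E"
    then have "{u, v} \<notin> E" using finE by simp
    then show "\<alpha> u v = 0" by (rule assms(7)[OF uv])
  qed
  ultimately have aldous: "aldous ?V \<alpha>" by (simp add: aldous_graph_def)
  have RW_sym: "RW_laplacian n \<alpha> i j = RW_laplacian n \<alpha> j i" if "i \<in> ?V" "j \<in> ?V" for i j
    by (rule RW_laplacian_sym[OF sym that])
  have rows: "(\<Sum>j\<in>?V. RW_laplacian n \<alpha> i j) = 0" if "i \<in> ?V" for i
    using apply_RW_laplacian[OF that sym, where g = "\<lambda>_. 1"] by (simp add: walk_op_def)
  have form: "kernel_form ?V (RW_laplacian n \<alpha>) g = walk_form ?V \<alpha> g" for g
  proof -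
    have "kernel_form ?V (RW_laplacian n \<alpha>) g = (\<Sum>x\<in>?V. g x * walk_op ?V \<alpha> g x)"
      by (intro sum.cong refl) (simp only: apply_RW_laplacian[OF _ sym])
    then show ?thesis by (simp only: sum_walk_op[OF sym])
  qed
  \<comment> \<open>The value \<open>l\<close> will be certified as the second eigenvalue of both
    matrices by the same criterion, \<open>second_smallest_eigenvalue_eqI\<close>.\<close>
  obtain l g where g: "mean_zero ?V g" "sq_norm ?V g = 1"
    and eigen: "\<And>i. i \<in> ?V \<Longrightarrow> apply_kernel ?V (RW_laplacian n \<alpha>) g i = l * g i"
    and min: "\<And>h. mean_zero ?V h \<Longrightarrow> l * sq_norm ?V h \<le> kernel_form ?V (RW_laplacian n \<alpha>) h"
  proof (rule rayleigh_minimizer[OF fin card, of "RW_laplacian n \<alpha>"])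
    show "RW_laplacian n \<alpha> i j = RW_laplacian n \<alpha> j i" if "i \<in> ?V" "j \<in> ?V" for i j
      using that by (rule RW_sym)
    show "(\<Sum>j\<in>?V. RW_laplacian n \<alpha> i j) = 0" if "i \<in> ?V" for i
      using that by (rule rows)
  qed (rule that)
  have nonconst: "\<exists>x\<in>?V. g x \<noteq> g 1"
  proof (rule ccontr)
    assume "\<not> ?thesis"
    then have const: "g x = g 1" if "x \<in> ?V" for x using that by blast
    have "(\<Sum>x\<in>?V. g x) = (\<Sum>x\<in>?V. g 1)" by (rule sum.cong[OF refl const])
    then have "g 1 = 0" using g(1) assms(1) by simp
    then have "sq_norm ?V g = 0" using const by (intro sum.neutral) simp
    then show False using g(2) by simp
  qed
  \<comment> \<open>Otherwise \<open>g\<close> has zero energy and is constant along edges of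
    nonzero weight; these connect all vertices.\<close>
  have l: "l > 0"
  proof (rule ccontr)
    assume "\<not> l > 0"
    have "walk_form ?V \<alpha> g = (\<Sum>i\<in>?V. g i * (l * g i))"
      unfolding form[symmetric] by (intro sum.cong refl) (simp only: eigen)
    also have "\<dots> = l * sq_norm ?V g" by (simp add: sum_distrib_left power2_eq_square mult_ac)
    finally have zero: "walk_form ?V \<alpha> g \<le> 0" using g(2) \<open>\<not> l > 0\<close> by simp
    have edge: "u \<in> ?V \<and> v \<in> ?V \<and> \<alpha> u v \<noteq> 0"
      if "{u, v} \<in> E - {{i, j} | i j. {i, j} \<in> E \<and> \<alpha> i j = 0}" for u v
    proof -
      have "{u, v} \<in> Pow ?V" by (rule subsetD[OF E DiffD1[OF that]])
      moreover have "\<alpha> u v \<noteq> 0" using that by blast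
      ultimately show ?thesis by simp
    qed
    have "g x = g 1" if "x \<in> ?V" for x
      by (rule walk_form_zero_imp_const[OF fin nonneg zero assms(8) edge that one])
    then show False using nonconst by blast
  qed
  have "sq_norm ?V g \<noteq> 0" unfolding g(2) by (rule one_neq_zero)
  then have "RW_gap n \<alpha> = l"
    unfolding RW_gap_def
    by (intro second_smallest_eigenvalue_eqI[OF fin RW_sym rows l _ eigen min])
  moreover have "interchange_gap n \<alpha> = l"
  proof -
    have finp: "finite (perms ?V)" using fin by (rule finite_permutations)
    have "interchange_gap n \<alpha> = second_smallest_eigenvalue (indexed_mat (perms ?V) (interchange_kernel ?V \<alpha>))"
    proof -
      have "interchange_laplacian n \<alpha> \<sigma> \<sigma>' = interchange_kernel ?V \<alpha> \<sigma> \<sigma>'" if "\<sigma> \<in> perms ?V" for \<sigma> \<sigma>'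
        by (rule interchange_laplacian_eq_kernel[OF sym CollectD[OF that]])
      then have "indexed_mat (perms ?V) (interchange_laplacian n \<alpha>) = indexed_mat (perms ?V) (interchange_kernel ?V \<alpha>)"
        by (rule indexed_mat_cong)
      then show ?thesis by (simp only: interchange_gap_def)
    qed
    also have "\<dots> = l"
    proof (rule second_smallest_eigenvalue_eqI[OF finp, of "interchange_kernel ?V \<alpha>" l "\<lambda>\<sigma>. g (\<sigma> 1)"])
      show "l > 0" by (fact l)
      show "interchange_kernel ?V \<alpha> \<sigma> \<sigma>' = interchange_kernel ?V \<alpha> \<sigma>' \<sigma>" for \<sigma> \<sigma>'
        by (rule interchange_kernel_sym)
      show "(\<Sum>\<sigma>'\<in>perms ?V. interchange_kernel ?V \<alpha> \<sigma> \<sigma>') = 0" if "\<sigma> \<in> perms ?V" for \<sigma>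
        by (rule interchange_kernel_rows[OF fin CollectD[OF that]])
      show "sq_norm (perms ?V) (\<lambda>\<sigma>. g (\<sigma> 1)) \<noteq> 0"
      proof
        assume zero: "sq_norm (perms ?V) (\<lambda>\<sigma>. g (\<sigma> 1)) = 0"
        have g0: "g x = 0" if "x \<in> ?V" for x
        proof -
          \<comment> \<open>This permutation takes 1 to \<open>x\<close>, so every value of
            \<open>g\<close> occurs in its lift.\<close>
          have "tr 1 x \<in> perms ?V" by (rule CollectI, rule tr_permutes[OF one that])
          from sq_norm_zero_imp[OF finp zero this] show ?thesis by (simp only: transpose_apply_first)
        qed
        obtain x where "x \<in> ?V" "g x \<noteq> g 1" using nonconst by (elim bexE)
        then show False by (simp only: g0 one)
      qed
      show "apply_kernel (perms ?V) (interchange_kernel ?V \<alpha>) (\<lambda>\<sigma>. g (\<sigma> 1)) \<sigma> = l * g (\<sigma> 1)"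
        if "\<sigma> \<in> perms ?V" for \<sigma>
      proof -
        have \<sigma>: "\<sigma> permutes ?V" using that by simp
        then have in_V: "\<sigma> 1 \<in> ?V" using one by (simp only: permutes_in_image)
        have "apply_kernel (perms ?V) (interchange_kernel ?V \<alpha>) (\<lambda>\<sigma>. g (\<sigma> 1)) \<sigma> =
            interchange_op ?V \<alpha> (\<lambda>\<sigma>. g (\<sigma> 1)) \<sigma>"
          by (rule apply_interchange_kernel[OF fin \<sigma>])
        also have "\<dots> = walk_op ?V \<alpha> g (\<sigma> 1)"
          by (rule interchange_op_one_point[OF fin one \<sigma> sym])
        also have "\<dots> = apply_kernel ?V (RW_laplacian n \<alpha>) g (\<sigma> 1)"
          by (rule apply_RW_laplacian[OF in_V sym, symmetric])
        also have "\<dots> = l * g (\<sigma> 1)" by (rule eigen[OF in_V])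
        finally show ?thesis .
      qed
      show "l * sq_norm (perms ?V) f \<le> kernel_form (perms ?V) (interchange_kernel ?V \<alpha>) f"
        if "mean_zero (perms ?V) f" for f
      proof -
        \<comment> \<open>Being the minimum of the walk's Rayleigh quotient, \<open>l\<close> is one
          of the bounds that \<open>aldous\<close> transfers.\<close>
        have "\<forall>h. mean_zero ?V h \<longrightarrow> l * sq_norm ?V h \<le> walk_form ?V \<alpha> h"
          using min unfolding form by (intro allI impI)
        from aldous[unfolded aldous_def, THEN spec, THEN mp, OF this] that
        show ?thesis unfolding interchange_kernel_form[OF fin] by simp
      qed
    qed
    finally show ?thesis .
  qed
  ultimately show ?thesis by simp
qed

end
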